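(* Let $F$ be a non-archimedean local field, let $n,n'\ge 0$ be integers, let $G_n=\mathrm{Sp}(W_n)$ with $W_n$ a symplectic $F$-space of dimension $2n$, and let $G'_{n'}=\mathrm{O}(V_{n'})$ with $V_{n'}$ a quadratic $F$-space of dimension $2n'$. For every inertial class $\mathfrak{s}\in\mathfrak{B}(G_n)$, the Howe correspondence $\pi\mapsto\theta_{n'}(\pi)$ for the reductive dual pair $(G_n,G'_{n'})$ induces a correspondence $E\mapsto\theta(E)$ between subsets of simple modules of the extended affine Hecke algebras $\mathcal{H}(G_n,\mathfrak{s})$ and $\mathcal{H}(G'_{n'},\theta(\mathfrak{s}))$.
   Context: Representations are smooth and complex. $\mathrm{Irr}(G)$ is the set of isomorphism classes of irreducible representations of $G$, and $\mathrm{Irr}(A)$ is the set of isomorphism classes of simple modules of an algebra $A$. **Bernstein series.** Let $G$ be $G_n$ or $G'_{n'}$ and $L$ a Levi subgroup of a parabolic subgroup of $G$. Let $\mathfrak{X}_{\mathrm{nr}}(L)$ be the group of unramified characters of $L$ (those trivial on all compact subgroups of $L$). For $\sigma$ an irreducible supercuspidal representation of $L$, the inertial class $[L,\sigma]_G$ is the $G$-conjugacy class of $(L,\{\sigma\otimes\chi:\chi\in\mathfrak{X}_{\mathrm{nr}}(L)\})$, and $\mathfrak{B}(G)$ is the set of such classes. For $\mathfrak{t}\in\mathfrak{B}(G)$, $\mathfrak{R}^{\mathfrak{t}}(G)$ is the full subcategory of smooth representations of $G$ all of whose irreducible subquotients have supercuspidal support in $\mathfrak{t}$, and $\mathrm{Irr}^{\mathfrak{t}}(G)$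 is the set of its irreducible objects. **Affine Hecke algebras.** Let $\mathcal{R}=(X,R,Y,R^\vee)$ be a root datum with basis $\Delta$ of $R$ and Weyl group $W$ with length function $\ell$. Let $q>1$ be real and let $\lambda,\lambda^*:R\to\mathbb{C}$ be functions such that $\lambda(\alpha)=\lambda(\beta)$ and $\lambda^*(\alpha)=\lambda^*(\beta)$ if $s_\alpha,s_\beta$ are conjugate in $W$, and $\lambda^*(\alpha)=\lambda(\alpha)$ if $\alpha^\vee\notin 2Y$. The affine Hecke algebra $\mathcal{H}(\mathcal{R},\lambda,\lambda^*,q)$ is the vector space $\mathbb{C}[X]\otimes\mathcal{H}(W,\mathbf{q})$ in which $\mathbb{C}[X]$ (basis $\theta_x$, $x\in X$) and the Iwahori–Hecke algebra $\mathcal{H}(W,\mathbf{q})$ (basis $T_w$, $w\in W$, with $T_wT_v=T_{wv}$ if $\ell(w)+\ell(v)=\ell(wv)$ and $(T_{s_\alpha}+1)(T_{s_\alpha}-q^{\lambda(\alpha)})=0$ for $\alpha\in\Delta$) are subalgebras, and, for $\alpha\in\Delta$, $x\in X$, $$\theta_xT_{s_\alpha}-T_{s_\alpha}\theta_{s_\alpha(x)}=\Big((q^{\lambda(\alpha)}-1)+\theta_{-\alpha}\big(q^{\frac{\lambda(\alpha)+\lambda^*(\alpha)}2}-q^{\frac{\lambda(\alpha)-\lambda^*(\alpha)}2}\big)\Big)\frac{\theta_x-\theta_{s_\alpha(x)}}{\theta_0-\theta_{-2\alpha}}.$$ An extended affine Hecke algebra is a crossed product of an affine Hecke algebra by the group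 algebra of a finite group. **The algebra $\mathcal{H}(G,\mathfrak{t})$.** For $\mathfrak{t}=[L,\sigma]_G$, put $W^{\mathfrak{t}}=\mathrm{N}_G([L,\sigma]_L)/L=W(\Sigma^{\mathfrak{t}})\rtimes\mathfrak{R}^{\mathfrak{t}}$, where $\Sigma^{\mathfrak{t}}$ is the root system of those roots of $G$ with respect to $L$ whose associated Harish-Chandra $\mu$-function has a zero on the orbit $\mathfrak{X}_{\mathrm{nr}}(L)\cdot\sigma$, $W(\Sigma^{\mathfrak{t}})$ is its Weyl group, and $\mathfrak{R}^{\mathfrak{t}}$ is the stabilizer in $W^{\mathfrak{t}}$ of the set of positive roots. By Heiermann, for $G$ symplectic or orthogonal, $\mathfrak{R}^{\mathfrak{t}}(G)$ is equivalent to the category of modules of an extended affine Hecke algebra $\mathcal{H}(G,\mathfrak{t})=\mathcal{H}(\mathcal{R},\lambda,\lambda^*,q)\rtimes\mathbb{C}[\mathfrak{R}^{\mathfrak{t}}]$ (no non-trivial $2$-cocycle occurs), with $\mathcal{R},\lambda,\lambda^*,q$ attached to $\mathfrak{t}$. This gives a bijection $\mathrm{Irr}^{\mathfrak{t}}(G)\to\mathrm{Irr}(\mathcal{H}(G,\mathfrak{t}))$. The correspondence $E\mapsto\theta(E)$ is obtained from $\pi\mapsto\theta_{n'}(\pi)$ through these bijections, using that $\theta_{n'}$ takes $\mathrm{Irr}^{\mathfrak{s}}(G_n)$ to $\mathrm{Irr}^{\theta(\mathfrak{s})}(G'_{n'})$. **Theta lifts.** Fix a non-trivial additive character $\psi$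 of $F$. Let $\omega_{n,n'}$ be the Weil representation of $G_n\times G'_{n'}$ obtained from the Weil representation (attached to $\psi$) of the metaplectic cover of the symplectic group $\mathrm{Sp}(W_n\otimes V_{n'})$ by means of Kudla's splitting. For $\pi\in\mathrm{Irr}(G_n)$ the maximal $\pi$-isotypic quotient of $\omega_{n,n'}$ is $\pi\otimes\Theta_{n'}(\pi)$. When $\Theta_{n'}(\pi)$ is non-zero it has a unique irreducible quotient $\theta_{n'}(\pi)$, the small theta lift of $\pi$; the Howe correspondence is $\pi\mapsto\theta_{n'}(\pi)$. Lifts of representations of $G'_{n'}$ to $G_n$ are defined symmetrically. The Witt tower of $V_{n'}$ consists of the quadratic spaces $V_{m'}$ (of dimension $2m'$) that are orthogonal sums of the anisotropic part of $V_{n'}$ and hyperbolic planes; put $G'_{m'}=\mathrm{O}(V_{m'})$. The symplectic spaces $W_m$, $m\ge0$, form the other tower. For an irreducible representation, $\theta^0$ denotes its first occurrence, that is, its small theta lift at the smallest index of the relevant tower at which that lift is non-zero. **The class $\theta(\mathfrak{s})$.** Let $\eta_{n'}$ be the character of $F^\times$ associated to $F(\sqrt{\Delta_{n'}})/F$, where $\Delta_{n'}$ is the discriminant of the form on $V_{n'}$, and let $\nu_F$ be the normalized absolute value on $F$, viewed as a character of $\mathrm{GL}_1(F)$. A Levi subgroup of $G_n$ has the form $L_n\simeq G_{n_0}\times\mathrm{GL}_{n_1}(F)\times\cdots\times\mathrm{GL}_{n_r}(F)$ with $n_0+\cdots+n_r=n$, and an irreducible supercuspidal representation of it has the form $\sigma\simeq\pi_{n_0}\otimes\tau_1\otimes\cdots\otimes\tau_r$.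 Likewise a Levi subgroup of $G'_{n'}$ has the form $L'_{n'}\simeq G'_{n'_0}\times\mathrm{GL}_{n'_1}(F)\times\cdots\times\mathrm{GL}_{n'_{r'}}(F)$ with $n'_0+\cdots+n'_{r'}=n'$, with supercuspidal representations $\sigma'\simeq\pi'_{n'_0}\otimes\tau'_1\otimes\cdots\otimes\tau'_{r'}$. Put $\overline n=n-n_0$, $\overline n'=n'-n'_0$, $d=n-n'$, $d_0=n_0-n'_0$. For $\mathfrak{s}=[L_n,\sigma]_{G_n}$ one sets $\theta(\mathfrak{s})=[L'_{n'},\sigma']_{G'_{n'}}$, where $(L'_{n'},\sigma')_{G'_{n'}}$ is the supercuspidal support of $\pi'=\theta_{n'}(\pi)$ for $\pi\in\mathrm{Irr}^{\mathfrak{s}}(G_n)$. It is related to the supercuspidal support $(L_n,\sigma)_{G_n}$ of $\pi$ by the following formula (quoted from Kudla), for $\Theta_{n'}(\pi)\ne\{0\}$ and $\pi'=\theta_{n'}(\pi)$: (1) if $\overline n'\le\overline n$, the supercuspidal support of $\pi'$ is $\left(L'_{n'},\pi'_{n'_0}\otimes\eta_{n'}^{-1}\tau_1\otimes\cdots\otimes\eta_{n'}^{-1}\tau_r\otimes\nu_F^{d-1}\otimes\nu_F^{d-2}\otimes\cdots\otimes\nu_F^{d_0}\right)_{G'_{n'}}$, where $\pi'_{n'_0}=\theta^0(\pi_{n_0})$; (2) if $\overline n'\ge\overline n$, the supercuspidal support of $\pi$ is $\left(L_n,\pi_{n_0}\otimes\eta_{n'}\tau'_1\otimes\cdots\otimes\eta_{n'}\tau'_{r'}\otimes\eta_{n'}\nu_F^{-d-1}\otimes\eta_{n'}\nu_F^{-d-2}\otimes\cdots\otimes\eta_{n'}\nu_F^{-d_0}\right)_{G_n}$,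 where $\pi_{n_0}=\theta^0(\pi'_{n'_0})$. Here $\eta_{n'}^{\pm1}\tau$ means the twist of $\tau$ by $\eta_{n'}^{\pm1}\circ\det$. *)

theory Defs
  imports
    "Jordan_Normal_Form.Determinant"
    "HOL-Library.Function_Algebras"
    "HOL-Complex_Analysis.Complex_Analysis"
begin

section \<open>Complex vector spaces as spaces of functions\<close>

text \<open>
  Every complex vector space below is a linear subspace of a space \<^typ>\<open>'x \<Rightarrow> complex\<close>, with
  pointwise operations.  Representations that are quantified over live in the universe
  \<^typ>\<open>nat \<Rightarrow> complex\<close>, which contains a copy of every complex vector space of dimension at most
  the continuum.  Irreducible smooth representations of classical \<open>p\<close>-adic groups, big theta lifts,
  extended affine Hecke algebras and their simple modules have countable dimension.
\<close>

definition smul :: "complex \<Rightarrow> ('x \<Rightarrow> complex) \<Rightarrow> 'x \<Rightarrow> complex"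
  where "smul c v = (\<lambda>i. c * v i)"

interpretation cfun: vector_space smul
  by standard (auto simp: smul_def fun_eq_iff algebra_simps)

definition lin_on :: "('x \<Rightarrow> complex) set \<Rightarrow> ('y \<Rightarrow> complex) set \<Rightarrow>
    (('x \<Rightarrow> complex) \<Rightarrow> 'y \<Rightarrow> complex) \<Rightarrow> bool"
  where "lin_on V W f \<longleftrightarrow> (\<forall>v\<in>V. f v \<in> W) \<and> (\<forall>u\<in>V. \<forall>v\<in>V. f (u + v) = f u + f v) \<and>
    (\<forall>c. \<forall>v\<in>V. f (smul c v) = smul c (f v))"


section \<open>Representations and modules\<close>

text \<open>
  A representation is a pair (space, action).  Only the values of the action on the acting set and
  on the space matter.  The same type serves for representations of a group and for modules over
  an algebra.
\<close>

type_synonym ('g, 'x) rep = "('x \<Rightarrow> complex) set \<times> ('g \<Rightarrow> ('x \<Rightarrow> complex) \<Rightarrow> 'x \<Rightarrow> complex)"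

definition monoid_rep :: "'g set \<Rightarrow> ('g \<Rightarrow> 'g \<Rightarrow> 'g) \<Rightarrow> 'g \<Rightarrow> ('g, 'x) rep \<Rightarrow> bool"
  where "monoid_rep S mul e \<pi> \<longleftrightarrow> cfun.subspace (fst \<pi>) \<and>
    (\<forall>a\<in>S. lin_on (fst \<pi>) (fst \<pi>) (snd \<pi> a)) \<and>
    (\<forall>a\<in>S. \<forall>b\<in>S. \<forall>v\<in>fst \<pi>. snd \<pi> (mul a b) v = snd \<pi> a (snd \<pi> b v)) \<and>
    (\<forall>v\<in>fst \<pi>. snd \<pi> e v = v)"

text \<open>Intertwining maps vanish outside the source, so that equality of morphisms is equality in HOL.\<close>

definition Homs :: "'g set \<Rightarrow> ('g, 'x) rep \<Rightarrow> ('g, 'y) rep \<Rightarrow> (('x \<Rightarrow> complex) \<Rightarrow> 'y \<Rightarrow> complex) set"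
  where "Homs S \<pi> \<pi>' = {f. lin_on (fst \<pi>) (fst \<pi>') f \<and> (\<forall>v. v \<notin> fst \<pi> \<longrightarrow> f v = 0) \<and>
    (\<forall>a\<in>S. \<forall>v\<in>fst \<pi>. f (snd \<pi> a v) = snd \<pi>' a (f v))}"

definition rep_iso :: "'g set \<Rightarrow> ('g, 'x) rep \<Rightarrow> ('g, 'y) rep \<Rightarrow> bool"
  where "rep_iso S \<pi> \<pi>' \<longleftrightarrow> (\<exists>f\<in>Homs S \<pi> \<pi>'. bij_betw f (fst \<pi>) (fst \<pi>'))"

definition is_quotient :: "'g set \<Rightarrow> ('g, 'x) rep \<Rightarrow> ('g, 'y) rep \<Rightarrow> bool"
  where "is_quotient S \<pi> \<pi>' \<longleftrightarrow> (\<exists>f\<in>Homs S \<pi> \<pi>'. f ` fst \<pi> = fst \<pi>')"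

definition invariant_subspace :: "'g set \<Rightarrow> ('g, 'x) rep \<Rightarrow> ('x \<Rightarrow> complex) set \<Rightarrow> bool"
  where "invariant_subspace S \<pi> U \<longleftrightarrow>
    cfun.subspace U \<and> U \<subseteq> fst \<pi> \<and> (\<forall>a\<in>S. \<forall>v\<in>U. snd \<pi> a v \<in> U)"

definition is_subquotient :: "'g set \<Rightarrow> ('g, 'x) rep \<Rightarrow> ('g, 'y) rep \<Rightarrow> bool"
  where "is_subquotient S \<pi> \<pi>' \<longleftrightarrow>
    (\<exists>U. invariant_subspace S \<pi> U \<and> is_quotient S (U, snd \<pi>) \<pi>')"

definition irreducible_rep :: "'g set \<Rightarrow> ('g, 'x) rep \<Rightarrow> bool"
  where "irreducible_rep S \<pi> \<longleftrightarrow> fst \<pi> \<noteq> {0} \<and>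
    (\<forall>U. invariant_subspace S \<pi> U \<longrightarrow> U = {0} \<or> U = fst \<pi>)"

definition iso_class :: "'g set \<Rightarrow> ('g, 'x) rep set \<Rightarrow> ('g, 'x) rep \<Rightarrow> ('g, 'x) rep set"
  where "iso_class S C \<pi> = {\<rho>\<in>C. rep_iso S \<pi> \<rho>}"

text \<open>
  Equivalences between full subcategories of the categories of representations of \<open>S1\<close> and of
  \<open>S2\<close>: a functor (\<open>Fo\<close> on objects, \<open>Fm\<close> on morphisms) that is fully faithful and essentially
  surjective.
\<close>

definition cat_equivalence :: "'g set \<Rightarrow> ('g, 'x) rep set \<Rightarrow> 'h set \<Rightarrow> ('h, 'y) rep set \<Rightarrow>
    (('g, 'x) rep \<Rightarrow> ('h, 'y) rep) \<Rightarrow>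
    (('g, 'x) rep \<Rightarrow> ('g, 'x) rep \<Rightarrow> (('x \<Rightarrow> complex) \<Rightarrow> 'x \<Rightarrow> complex) \<Rightarrow> ('y \<Rightarrow> complex) \<Rightarrow> 'y \<Rightarrow> complex) \<Rightarrow>
    bool"
  where "cat_equivalence S1 C1 S2 C2 Fo Fm \<longleftrightarrow>
    (\<forall>\<pi>\<in>C1. Fo \<pi> \<in> C2) \<and>
    (\<forall>\<pi>\<in>C1. Fm \<pi> \<pi> (\<lambda>v. if v \<in> fst \<pi> then v else 0) = (\<lambda>v. if v \<in> fst (Fo \<pi>) then v else 0)) \<and>
    (\<forall>\<pi>1\<in>C1. \<forall>\<pi>2\<in>C1. \<forall>\<pi>3\<in>C1. \<forall>f\<in>Homs S1 \<pi>1 \<pi>2. \<forall>g\<in>Homs S1 \<pi>2 \<pi>3.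
       Fm \<pi>1 \<pi>3 (g \<circ> f) = Fm \<pi>2 \<pi>3 g \<circ> Fm \<pi>1 \<pi>2 f) \<and>
    (\<forall>\<pi>1\<in>C1. \<forall>\<pi>2\<in>C1. bij_betw (Fm \<pi>1 \<pi>2) (Homs S1 \<pi>1 \<pi>2) (Homs S2 (Fo \<pi>1) (Fo \<pi>2))) \<and>
    (\<forall>\<rho>\<in>C2. \<exists>\<pi>\<in>C1. rep_iso S2 (Fo \<pi>) \<rho>)"


section \<open>Algebras and extended affine Hecke algebras\<close>

text \<open>An algebra is a triple (underlying space, multiplication, unit).\<close>

type_synonym 'x calg =
  "('x \<Rightarrow> complex) set \<times> (('x \<Rightarrow> complex) \<Rightarrow> ('x \<Rightarrow> complex) \<Rightarrow> 'x \<Rightarrow> complex) \<times> ('x \<Rightarrow> complex)"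

abbreviation alg_set :: "'x calg \<Rightarrow> ('x \<Rightarrow> complex) set" where "alg_set A \<equiv> fst A"
abbreviation alg_mul :: "'x calg \<Rightarrow> ('x \<Rightarrow> complex) \<Rightarrow> ('x \<Rightarrow> complex) \<Rightarrow> 'x \<Rightarrow> complex"
  where "alg_mul A \<equiv> fst (snd A)"
abbreviation alg_one :: "'x calg \<Rightarrow> 'x \<Rightarrow> complex" where "alg_one A \<equiv> snd (snd A)"

definition complex_algebra :: "'x calg \<Rightarrow> bool"
  where "complex_algebra A \<longleftrightarrow> cfun.subspace (alg_set A) \<and> alg_one A \<in> alg_set A \<and>
    (\<forall>a\<in>alg_set A. lin_on (alg_set A) (alg_set A) (alg_mul A a)) \<and>
    (\<forall>a\<in>alg_set A. lin_on (alg_set A) (alg_set A) (\<lambda>b. alg_mul A b a)) \<and>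
    (\<forall>a\<in>alg_set A. \<forall>b\<in>alg_set A. \<forall>c\<in>alg_set A.
       alg_mul A (alg_mul A a b) c = alg_mul A a (alg_mul A b c)) \<and>
    (\<forall>a\<in>alg_set A. alg_mul A (alg_one A) a = a \<and> alg_mul A a (alg_one A) = a)"

definition modules :: "'x calg \<Rightarrow> ('x \<Rightarrow> complex, nat) rep set"
  where "modules A = {M. monoid_rep (alg_set A) (alg_mul A) (alg_one A) M \<and>
    (\<forall>v\<in>fst M. lin_on (alg_set A) (fst M) (\<lambda>a. snd M a v))}"

definition Irr_alg :: "'x calg \<Rightarrow> ('x \<Rightarrow> complex, nat) rep set set"
  where "Irr_alg A = iso_class (alg_set A) (modules A) ` {M\<in>modules A. irreducible_rep (alg_set A) M}"

text \<open>
  Both \<open>X\<close> and \<open>Y\<close> of a root datum are the lattice of integer sequences supported on the first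
  \<open>rk\<close> places, with the standard perfect pairing.
\<close>

record root_data =
  rk :: nat
  roots :: "(nat \<Rightarrow> int) set"
  coroot :: "(nat \<Rightarrow> int) \<Rightarrow> nat \<Rightarrow> int"
  simple :: "(nat \<Rightarrow> int) set"

definition lattice_of :: "root_data \<Rightarrow> (nat \<Rightarrow> int) set"
  where "lattice_of D = {x. \<forall>i\<ge>rk D. x i = 0}"

definition pairing :: "root_data \<Rightarrow> (nat \<Rightarrow> int) \<Rightarrow> (nat \<Rightarrow> int) \<Rightarrow> int"
  where "pairing D x y = (\<Sum>i<rk D. x i * y i)"

definition root_refl :: "root_data \<Rightarrow> (nat \<Rightarrow> int) \<Rightarrow> (nat \<Rightarrow> int) \<Rightarrow> nat \<Rightarrow> int"
  where "root_refl D \<alpha> x = (\<lambda>i. x i - pairing D x (coroot D \<alpha>) * \<alpha> i)"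

definition positive_root :: "root_data \<Rightarrow> (nat \<Rightarrow> int) \<Rightarrow> bool"
  where "positive_root D \<beta> \<longleftrightarrow> \<beta> \<in> roots D \<and>
    (\<exists>c::(nat \<Rightarrow> int) \<Rightarrow> nat. \<forall>i. \<beta> i = (\<Sum>\<alpha>\<in>simple D. int (c \<alpha>) * \<alpha> i))"

definition root_datum :: "root_data \<Rightarrow> bool"
  where "root_datum D \<longleftrightarrow>
    finite (roots D) \<and> roots D \<subseteq> lattice_of D \<and> coroot D ` roots D \<subseteq> lattice_of D \<and>
    inj_on (coroot D) (roots D) \<and>
    (\<forall>\<alpha>\<in>roots D. pairing D \<alpha> (coroot D \<alpha>) = 2) \<and>
    (\<forall>\<alpha>\<in>roots D. \<forall>\<beta>\<in>roots D. root_refl D \<alpha> \<beta> \<in> roots D \<and>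
       (\<forall>i. coroot D (root_refl D \<alpha> \<beta>) i =
          coroot D \<beta> i - pairing D \<alpha> (coroot D \<beta>) * coroot D \<alpha> i)) \<and>
    simple D \<subseteq> roots D \<and>
    (\<forall>c::(nat \<Rightarrow> int) \<Rightarrow> int. (\<forall>i. (\<Sum>\<alpha>\<in>simple D. c \<alpha> * \<alpha> i) = 0) \<longrightarrow> (\<forall>\<alpha>\<in>simple D. c \<alpha> = 0)) \<and>
    (\<forall>\<beta>\<in>roots D. positive_root D \<beta> \<or> positive_root D (\<lambda>i. - \<beta> i))"

definition refl_word :: "root_data \<Rightarrow> (nat \<Rightarrow> int) list \<Rightarrow> (nat \<Rightarrow> int) \<Rightarrow> nat \<Rightarrow> int"
  where "refl_word D as = foldr (\<lambda>\<alpha> w. root_refl D \<alpha> \<circ> w) as id"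

definition weyl :: "root_data \<Rightarrow> ((nat \<Rightarrow> int) \<Rightarrow> nat \<Rightarrow> int) set"
  where "weyl D = {refl_word D as | as. set as \<subseteq> simple D}"

definition weyl_length :: "root_data \<Rightarrow> ((nat \<Rightarrow> int) \<Rightarrow> nat \<Rightarrow> int) \<Rightarrow> nat"
  where "weyl_length D w = (LEAST k. \<exists>as. set as \<subseteq> simple D \<and> length as = k \<and> w = refl_word D as)"

definition hecke_parameters :: "root_data \<Rightarrow> ((nat \<Rightarrow> int) \<Rightarrow> complex) \<Rightarrow> ((nat \<Rightarrow> int) \<Rightarrow> complex) \<Rightarrow> bool"
  where "hecke_parameters D l ls \<longleftrightarrow>
    (\<forall>\<alpha>\<in>roots D. \<forall>\<beta>\<in>roots D.
       (\<exists>w\<in>weyl D. w \<circ> root_refl D \<alpha> = root_refl D \<beta> \<circ> w) \<longrightarrow> l \<alpha> = l \<beta> \<and> ls \<alpha> = ls \<beta>) \<and>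
    (\<forall>\<alpha>\<in>roots D. (\<nexists>y. y \<in> lattice_of D \<and> coroot D \<alpha> = y + y) \<longrightarrow> ls \<alpha> = l \<alpha>)"

text \<open>
  \<open>affine_hecke D l ls q A \<theta> T\<close>: the algebra \<open>A\<close> is the affine Hecke algebra with parameters
  \<open>l\<close> (for $\lambda$), \<open>ls\<close> (for $\lambda^*$) and \<open>q\<close>.  The isomorphism of vector spaces
  $A = \mathbb{C}[X] \otimes \mathcal{H}(W,q)$ is expressed by saying that the products
  $\theta_x T_w$ form a basis of \<open>A\<close>.  In the last clause \<open>b\<close> is the element of $\mathbb{C}[X]$
  denoted by the fraction in the Bernstein relation.
\<close>

definition affine_hecke :: "root_data \<Rightarrow> ((nat \<Rightarrow> int) \<Rightarrow> complex) \<Rightarrow> ((nat \<Rightarrow> int) \<Rightarrow> complex) \<Rightarrow> real \<Rightarrow>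
    'x calg \<Rightarrow> ((nat \<Rightarrow> int) \<Rightarrow> 'x \<Rightarrow> complex) \<Rightarrow>
    (((nat \<Rightarrow> int) \<Rightarrow> nat \<Rightarrow> int) \<Rightarrow> 'x \<Rightarrow> complex) \<Rightarrow> bool"
  where "affine_hecke D l ls q A \<theta> T \<longleftrightarrow>
    (let X = lattice_of D; W = weyl D; m = alg_mul A; Q = (\<lambda>z. of_real q powr z) :: complex \<Rightarrow> complex in
     root_datum D \<and> hecke_parameters D l ls \<and> q > 1 \<and> complex_algebra A \<and>
     \<theta> ` X \<subseteq> alg_set A \<and> T ` W \<subseteq> alg_set A \<and>
     inj_on (\<lambda>(x, w). m (\<theta> x) (T w)) (X \<times> W) \<and>
     \<not> cfun.dependent ((\<lambda>(x, w). m (\<theta> x) (T w)) ` (X \<times> W)) \<and>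
     cfun.span ((\<lambda>(x, w). m (\<theta> x) (T w)) ` (X \<times> W)) = alg_set A \<and>
     \<theta> 0 = alg_one A \<and> (\<forall>x\<in>X. \<forall>y\<in>X. m (\<theta> x) (\<theta> y) = \<theta> (x + y)) \<and>
     T id = alg_one A \<and>
     (\<forall>w\<in>W. \<forall>v\<in>W. weyl_length D w + weyl_length D v = weyl_length D (w \<circ> v) \<longrightarrow>
        m (T w) (T v) = T (w \<circ> v)) \<and>
     (\<forall>\<alpha>\<in>simple D. m (T (root_refl D \<alpha>) + alg_one A)
        (T (root_refl D \<alpha>) - smul (Q (l \<alpha>)) (alg_one A)) = 0) \<and>
     (\<forall>\<alpha>\<in>simple D. \<forall>x\<in>X. \<exists>b\<in>cfun.span (\<theta> ` X).
        m (\<theta> x) (T (root_refl D \<alpha>)) - m (T (root_refl D \<alpha>)) (\<theta> (root_refl D \<alpha> x)) = b \<and>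
        m b (\<theta> 0 - \<theta> (- \<alpha> - \<alpha>)) =
          m (smul (Q (l \<alpha>) - 1) (\<theta> 0) +
             smul (Q ((l \<alpha> + ls \<alpha>) / 2) - Q ((l \<alpha> - ls \<alpha>) / 2)) (\<theta> (- \<alpha>)))
            (\<theta> x - \<theta> (root_refl D \<alpha> x))))"

text \<open>
  \<open>C\<close> is the crossed product of its subalgebra \<open>A\<close> with the group algebra of the finite group \<open>K\<close>
  (multiplication \<open>gm\<close>, unit \<open>g1\<close>): the $u_k$ multiply as in \<open>K\<close>, conjugation by $u_k$ maps \<open>A\<close>
  to itself, and $C = \bigoplus_k A\, u_k$.
\<close>

definition crossed_product :: "'x calg \<Rightarrow> 'k set \<Rightarrow> ('k \<Rightarrow> 'k \<Rightarrow> 'k) \<Rightarrow> 'k \<Rightarrow> 'x calg \<Rightarrow>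
    ('k \<Rightarrow> 'x \<Rightarrow> complex) \<Rightarrow> bool"
  where "crossed_product A K gm g1 C u \<longleftrightarrow>
    complex_algebra A \<and> complex_algebra C \<and> finite K \<and> u ` K \<subseteq> alg_set C \<and>
    alg_set A \<subseteq> alg_set C \<and> alg_one C = alg_one A \<and>
    (\<forall>a\<in>alg_set A. \<forall>b\<in>alg_set A. alg_mul C a b = alg_mul A a b) \<and>
    u g1 = alg_one C \<and> (\<forall>k\<in>K. \<forall>k'\<in>K. alg_mul C (u k) (u k') = u (gm k k')) \<and>
    (\<forall>k\<in>K. \<forall>a\<in>alg_set A. \<exists>b\<in>alg_set A. alg_mul C (u k) a = alg_mul C b (u k)) \<and>
    (\<forall>x\<in>alg_set C. \<exists>a. a ` K \<subseteq> alg_set A \<and> x = (\<Sum>k\<in>K. alg_mul C (a k) (u k))) \<and>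
    (\<forall>a. a ` K \<subseteq> alg_set A \<and> (\<Sum>k\<in>K. alg_mul C (a k) (u k)) = 0 \<longrightarrow> (\<forall>k\<in>K. a k = 0))"


section \<open>Local fields and matrix groups\<close>

text \<open>Residue field of the valuation ring \<open>{x. av x \<le> 1}\<close>.\<close>

definition residue_field :: "('f::field \<Rightarrow> real) \<Rightarrow> 'f set set"
  where "residue_field av = (\<lambda>x. {y. av (y - x) < 1}) ` {x. av x \<le> 1}"

text \<open>
  \<open>'f\<close> is a non-archimedean local field with normalized absolute value \<open>av\<close>: complete and discretely
  valued with finite residue field.  The last two clauses say that the largest absolute value
  below 1 is the inverse of the residue cardinality.
\<close>

definition local_field :: "('f::field \<Rightarrow> real) \<Rightarrow> bool"
  where "local_field av \<longleftrightarrow>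
    (\<forall>x. av x \<ge> 0) \<and> (\<forall>x. av x = 0 \<longleftrightarrow> x = 0) \<and> (\<forall>x y. av (x * y) = av x * av y) \<and>
    (\<forall>x y. av (x + y) \<le> max (av x) (av y)) \<and>
    (\<forall>X::nat \<Rightarrow> 'f. (\<forall>e>0. \<exists>N. \<forall>i\<ge>N. \<forall>j\<ge>N. av (X i - X j) < e) \<longrightarrow>
       (\<exists>l. \<forall>e>0. \<exists>N. \<forall>i\<ge>N. av (X i - l) < e)) \<and>
    finite (residue_field av) \<and>
    (\<exists>x. av x = 1 / real (card (residue_field av))) \<and>
    (\<forall>x. av x < 1 \<longrightarrow> av x \<le> 1 / real (card (residue_field av)))"

definition mat_le :: "('f \<Rightarrow> real) \<Rightarrow> real \<Rightarrow> 'f mat \<Rightarrow> bool"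
  where "mat_le av r A \<longleftrightarrow> (\<forall>i<dim_row A. \<forall>j<dim_col A. av (A $$ (i, j)) \<le> r)"

definition near_one :: "('f::field \<Rightarrow> real) \<Rightarrow> real \<Rightarrow> 'f mat \<Rightarrow> bool"
  where "near_one av r g \<longleftrightarrow> mat_le av r (g - 1\<^sub>m (dim_row g))"

definition mat_inv :: "'f::field mat \<Rightarrow> 'f mat"
  where "mat_inv g = (THE h. h \<in> carrier_mat (dim_row g) (dim_row g) \<and>
    g * h = 1\<^sub>m (dim_row g) \<and> h * g = 1\<^sub>m (dim_row g))"

definition conj_set :: "'f::field mat \<Rightarrow> 'f mat set \<Rightarrow> 'f mat set"
  where "conj_set g L = (\<lambda>l. g * l * mat_inv g) ` L"

text \<open>All groups considered are closed subgroups of some general linear group, with the topology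
  given by the entries.\<close>

definition mat_subgroup :: "nat \<Rightarrow> 'f::field mat set \<Rightarrow> bool"
  where "mat_subgroup N K \<longleftrightarrow> K \<subseteq> carrier_mat N N \<and> 1\<^sub>m N \<in> K \<and> (\<forall>g\<in>K. \<forall>h\<in>K. g * h \<in> K) \<and>
    (\<forall>g\<in>K. \<exists>h\<in>K. g * h = 1\<^sub>m N \<and> h * g = 1\<^sub>m N)"

definition mat_compact :: "('f::field \<Rightarrow> real) \<Rightarrow> 'f mat set \<Rightarrow> bool"
  where "mat_compact av K \<longleftrightarrow> (\<forall>X::nat \<Rightarrow> 'f mat. (\<forall>i. X i \<in> K) \<longrightarrow>
    (\<exists>(r::nat \<Rightarrow> nat) A. strict_mono r \<and> A \<in> K \<and> (\<forall>e>0. \<exists>M. \<forall>i\<ge>M. mat_le av e (X (r i) - A))))"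

text \<open>\<open>left_cosets H K\<close> is $H/(H \cap K)$.\<close>

definition left_cosets :: "'f::field mat set \<Rightarrow> 'f mat set \<Rightarrow> 'f mat set set"
  where "left_cosets H K = (\<lambda>h. (\<lambda>k. h * k) ` (H \<inter> K)) ` H"

definition isom_group :: "nat \<Rightarrow> 'f::field mat \<Rightarrow> 'f mat set"
  where "isom_group N B = {g\<in>carrier_mat N N. transpose_mat g * B * g = B}"

definition symplectic_form :: "nat \<Rightarrow> 'f::field mat"
  where "symplectic_form n = Matrix.mat (2 * n) (2 * n) (\<lambda>(i, j). if j = i + n then 1 else if i = j + n then -1 else 0)"

definition quadratic_space :: "nat \<Rightarrow> 'f::field mat \<Rightarrow> bool"
  where "quadratic_space m Q \<longleftrightarrow> Q \<in> carrier_mat m m \<and> transpose_mat Q = Q \<and> Determinant.det Q \<noteq> 0"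

abbreviation Sp :: "nat \<Rightarrow> 'f::field mat set"
  where "Sp n \<equiv> isom_group (2 * n) (symplectic_form n)"


section \<open>Parabolic and Levi subgroups\<close>

text \<open>
  A grading is a decomposition $F^N = \bigoplus_{k \in \mathbb{Z}} E_k$, given by its projections
  \<open>e k\<close>, such that $E_j$ and $E_k$ are orthogonal for \<open>B\<close> unless $j + k = 0$.  The associated
  filtration consists of the isotropic subspaces $\bigoplus_{j \ge k} E_j$ ($k > 0$) and their
  orthogonals, so the stabilizers of gradings and of their filtrations are exactly the Levi
  subgroups (an isometry group of $E_0$ times general linear groups of the $E_k$, $k > 0$) and the
  parabolic subgroups of the isometry group.
\<close>

definition grading :: "nat \<Rightarrow> 'f::field mat \<Rightarrow> (int \<Rightarrow> 'f mat) \<Rightarrow> bool"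
  where "grading N B e \<longleftrightarrow>
    (\<forall>k. e k \<in> carrier_mat N N) \<and> finite {k. e k \<noteq> 0\<^sub>m N N} \<and>
    (\<forall>j k. e j * e k = (if j = k then e k else 0\<^sub>m N N)) \<and>
    (\<forall>i<N. \<forall>j<N. (\<Sum>k | e k \<noteq> 0\<^sub>m N N. e k $$ (i, j)) = 1\<^sub>m N $$ (i, j)) \<and>
    (\<forall>k. transpose_mat (e k) * B = B * e (- k))"

text \<open>For \<open>H\<close> the isometry group or one of its Levi subgroups: Levi factor, parabolic subgroup and
  unipotent radical in \<open>H\<close> defined by \<open>e\<close>.\<close>

definition levi :: "'f::field mat set \<Rightarrow> (int \<Rightarrow> 'f mat) \<Rightarrow> 'f mat set"
  where "levi H e = {g\<in>H. \<forall>k. g * e k = e k * g}"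

definition par :: "'f::field mat set \<Rightarrow> (int \<Rightarrow> 'f mat) \<Rightarrow> 'f mat set"
  where "par H e = {g\<in>H. \<forall>j k. j < k \<longrightarrow> e j * g * e k = 0\<^sub>m (dim_row g) (dim_row g)}"

definition unip :: "'f::field mat set \<Rightarrow> (int \<Rightarrow> 'f mat) \<Rightarrow> 'f mat set"
  where "unip H e = {g\<in>par H e. \<forall>k. e k * g * e k = e k}"

definition opp :: "(int \<Rightarrow> 'f mat) \<Rightarrow> int \<Rightarrow> 'f mat"
  where "opp e = (\<lambda>k. e (- k))"

definition levi_subgroups :: "nat \<Rightarrow> 'f::field mat \<Rightarrow> 'f mat set set"
  where "levi_subgroups N B = {levi (isom_group N B) e | e. grading N B e}"

text \<open>Gradings that define the parabolic subgroups of a Levi subgroup \<open>L\<close>: those compatible with a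
  grading defining \<open>L\<close>.\<close>

definition gradings_of :: "nat \<Rightarrow> 'f::field mat \<Rightarrow> 'f mat set \<Rightarrow> (int \<Rightarrow> 'f mat) set"
  where "gradings_of N B L = {e. grading N B e \<and>
    (\<exists>d. grading N B d \<and> levi (isom_group N B) d = L \<and> (\<forall>j k. e j * d k = d k * e j))}"


section \<open>Smooth representations and the Bernstein decomposition\<close>

definition smooth_rep :: "('f::field \<Rightarrow> real) \<Rightarrow> nat \<Rightarrow> 'f mat set \<Rightarrow> ('f mat, 'x) rep \<Rightarrow> bool"
  where "smooth_rep av N G \<pi> \<longleftrightarrow> monoid_rep G (*) (1\<^sub>m N) \<pi> \<and>
    (\<forall>v\<in>fst \<pi>. \<exists>\<epsilon>>0. \<forall>g\<in>G. near_one av \<epsilon> g \<longrightarrow> snd \<pi> g v = v)"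

definition Irr_smooth :: "('f::field \<Rightarrow> real) \<Rightarrow> nat \<Rightarrow> 'f mat set \<Rightarrow> ('f mat, nat) rep set"
  where "Irr_smooth av N G = {\<pi>. smooth_rep av N G \<pi> \<and> irreducible_rep G \<pi>}"

definition jacquet_zero :: "'f::field mat set \<Rightarrow> ('f mat, 'x) rep \<Rightarrow> bool"
  where "jacquet_zero U \<pi> \<longleftrightarrow> fst \<pi> \<subseteq> cfun.span {snd \<pi> u v - v | u v. u \<in> U \<and> v \<in> fst \<pi>}"

definition supercuspidal :: "('f::field \<Rightarrow> real) \<Rightarrow> nat \<Rightarrow> 'f mat \<Rightarrow> 'f mat set \<Rightarrow> ('f mat, nat) rep \<Rightarrow> bool"
  where "supercuspidal av N B L \<sigma> \<longleftrightarrow> \<sigma> \<in> Irr_smooth av N L \<and>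
    (\<forall>e\<in>gradings_of N B L. par L e \<noteq> L \<longrightarrow> jacquet_zero (unip L e) \<sigma>)"

definition unramified :: "('f::field \<Rightarrow> real) \<Rightarrow> nat \<Rightarrow> 'f mat set \<Rightarrow> ('f mat \<Rightarrow> complex) \<Rightarrow> bool"
  where "unramified av N L \<kappa> \<longleftrightarrow> (\<forall>g\<in>L. \<kappa> g \<noteq> 0) \<and> (\<forall>g\<in>L. \<forall>h\<in>L. \<kappa> (g * h) = \<kappa> g * \<kappa> h) \<and>
    (\<forall>K. mat_subgroup N K \<and> K \<subseteq> L \<and> mat_compact av K \<longrightarrow> (\<forall>k\<in>K. \<kappa> k = 1))"

definition twist :: "('g \<Rightarrow> complex) \<Rightarrow> ('g, 'x) rep \<Rightarrow> ('g, 'x) rep"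
  where "twist \<kappa> \<sigma> = (fst \<sigma>, \<lambda>g v. smul (\<kappa> g) (snd \<sigma> g v))"

definition conj_rep :: "'f::field mat \<Rightarrow> ('f mat, 'x) rep \<Rightarrow> ('f mat, 'x) rep"
  where "conj_rep g \<sigma> = (fst \<sigma>, \<lambda>l. snd \<sigma> (mat_inv g * l * g))"

type_synonym 'f cusp_pair = "'f mat set \<times> ('f mat, nat) rep"

definition cuspidal_pairs :: "('f::field \<Rightarrow> real) \<Rightarrow> nat \<Rightarrow> 'f mat \<Rightarrow> 'f cusp_pair set"
  where "cuspidal_pairs av N B = {(L, \<sigma>). L \<in> levi_subgroups N B \<and> supercuspidal av N B L \<sigma>}"

definition inertial_class :: "('f::field \<Rightarrow> real) \<Rightarrow> nat \<Rightarrow> 'f mat \<Rightarrow> 'f cusp_pair \<Rightarrow> 'f cusp_pair set"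
  where "inertial_class av N B = (\<lambda>(L, \<sigma>). {(L', \<sigma>') \<in> cuspidal_pairs av N B.
    \<exists>g\<in>isom_group N B. \<exists>\<kappa>. unramified av N L \<kappa> \<and> L' = conj_set g L \<and>
      rep_iso L' \<sigma>' (conj_rep g (twist \<kappa> \<sigma>))})"

definition bernstein :: "('f::field \<Rightarrow> real) \<Rightarrow> nat \<Rightarrow> 'f mat \<Rightarrow> 'f cusp_pair set set"
  where "bernstein av N B = inertial_class av N B ` cuspidal_pairs av N B"

text \<open>The modulus $\delta_P$, as the factor by which conjugation scales the Haar measure of the
  unipotent radical, measured on the compact open subgroup of integral matrices.\<close>

definition modulus :: "('f::field \<Rightarrow> real) \<Rightarrow> 'f mat set \<Rightarrow> (int \<Rightarrow> 'f mat) \<Rightarrow> 'f mat \<Rightarrow> real"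
  where "modulus av H e p = (let K = {u\<in>unip H e. mat_le av 1 u} in
    real (card (left_cosets (conj_set p K) K)) / real (card (left_cosets K (conj_set p K))))"

text \<open>Normalized parabolic induction from \<open>par H e\<close> to \<open>H\<close> of a representation of \<open>levi H e\<close>; a
  function \<open>f\<close> from \<open>H\<close> to the space of the representation is encoded as \<open>\<lambda>(g, i). f g i\<close>.\<close>

definition induced :: "('f::field \<Rightarrow> real) \<Rightarrow> 'f mat set \<Rightarrow> (int \<Rightarrow> 'f mat) \<Rightarrow> ('f mat, 'x) rep \<Rightarrow>
    ('f mat, 'f mat \<times> 'x) rep"
  where "induced av H e \<sigma> =
    ({f. (\<forall>g i. g \<notin> H \<longrightarrow> f (g, i) = 0) \<and> (\<forall>g\<in>H. (\<lambda>i. f (g, i)) \<in> fst \<sigma>) \<and>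
       (\<forall>l\<in>levi H e. \<forall>u\<in>unip H e. \<forall>g\<in>H. (\<lambda>i. f (l * u * g, i)) =
          smul (of_real (sqrt (modulus av H e l))) (snd \<sigma> l (\<lambda>i. f (g, i)))) \<and>
       (\<exists>\<epsilon>>0. \<forall>g\<in>H. \<forall>k\<in>H. near_one av \<epsilon> k \<longrightarrow> (\<forall>i. f (g * k, i) = f (g, i)))},
     \<lambda>x f (g, i). if g \<in> H then f (g * x, i) else 0)"

text \<open>The supercuspidal support of an irreducible representation, as a set of cuspidal pairs (it is
  a single conjugacy class).\<close>

definition supp :: "('f::field \<Rightarrow> real) \<Rightarrow> nat \<Rightarrow> 'f mat \<Rightarrow> ('f mat, nat) rep \<Rightarrow> 'f cusp_pair set"
  where "supp av N B \<pi> = {(L, \<sigma>) \<in> cuspidal_pairs av N B. \<exists>e. grading N B e \<and>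
    levi (isom_group N B) e = L \<and>
    is_subquotient (isom_group N B) (induced av (isom_group N B) e \<sigma>) \<pi>}"

definition bernstein_block :: "('f::field \<Rightarrow> real) \<Rightarrow> nat \<Rightarrow> 'f mat \<Rightarrow> 'f cusp_pair set \<Rightarrow> ('f mat, nat) rep set"
  where "bernstein_block av N B t = {\<pi>. smooth_rep av N (isom_group N B) \<pi> \<and>
    (\<forall>\<rho>\<in>Irr_smooth av N (isom_group N B). is_subquotient (isom_group N B) \<pi> \<rho> \<longrightarrow>
       supp av N B \<rho> \<noteq> {} \<and> supp av N B \<rho> \<subseteq> t)}"

definition Irr_block :: "('f::field \<Rightarrow> real) \<Rightarrow> nat \<Rightarrow> 'f mat \<Rightarrow> 'f cusp_pair set \<Rightarrow> ('f mat, nat) rep set"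
  where "Irr_block av N B t = {\<pi>\<in>bernstein_block av N B t. irreducible_rep (isom_group N B) \<pi>}"


section \<open>Intertwining operators and the Harish-Chandra \<open>\<mu>\<close>-function\<close>

text \<open>
  A reduced root $\alpha$ of the group with respect to \<open>L\<close> is encoded as the pair
  $(M_\alpha, U_\alpha)$: a Levi subgroup minimal among those strictly containing \<open>L\<close>, and the
  (non-trivial) unipotent radical of one of the two parabolic subgroups of $M_\alpha$ with Levi
  factor \<open>L\<close>, so that $-\alpha$ corresponds to the opposite unipotent radical.
\<close>

definition min_over :: "nat \<Rightarrow> 'f::field mat \<Rightarrow> 'f mat set \<Rightarrow> 'f mat set \<Rightarrow> bool"
  where "min_over N B L M \<longleftrightarrow> M \<in> levi_subgroups N B \<and> L \<subset> M \<and>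
    (\<nexists>M'. M' \<in> levi_subgroups N B \<and> L \<subset> M' \<and> M' \<subset> M)"

definition smooth_functional :: "('f::field \<Rightarrow> real) \<Rightarrow> 'f mat set \<Rightarrow> ('f mat, 'x) rep \<Rightarrow>
    (('x \<Rightarrow> complex) \<Rightarrow> complex) \<Rightarrow> bool"
  where "smooth_functional av L \<sigma> \<xi> \<longleftrightarrow>
    (\<forall>u\<in>fst \<sigma>. \<forall>v\<in>fst \<sigma>. \<xi> (u + v) = \<xi> u + \<xi> v) \<and> (\<forall>c. \<forall>v\<in>fst \<sigma>. \<xi> (smul c v) = c * \<xi> v) \<and>
    (\<exists>\<epsilon>>0. \<forall>l\<in>L. near_one av \<epsilon> l \<longrightarrow> (\<forall>v\<in>fst \<sigma>. \<xi> (snd \<sigma> l v) = \<xi> v))"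

text \<open>
  \<open>intertwining_integral av M e \<sigma> f g v\<close>: the integral $\int_{\overline N} f(ng)\,dn$ converges
  absolutely (against smooth functionals) to \<open>v\<close>, where $\overline N$ is the opposite unipotent
  radical, with Haar measure giving its integral matrices volume 1.  The integrand is invariant
  under right translation of \<open>n\<close> by the elements of $\overline N$ close to 1, so the integral is a
  sum over cosets.
\<close>

definition intertwining_integral :: "('f::field \<Rightarrow> real) \<Rightarrow> 'f mat set \<Rightarrow> (int \<Rightarrow> 'f mat) \<Rightarrow>
    ('f mat, 'x) rep \<Rightarrow> ('f mat \<times> 'x \<Rightarrow> complex) \<Rightarrow> 'f mat \<Rightarrow> ('x \<Rightarrow> complex) \<Rightarrow> bool"
  where "intertwining_integral av M e \<sigma> f g v \<longleftrightarrow> v \<in> fst \<sigma> \<and>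
    (\<exists>\<epsilon>. 0 < \<epsilon> \<and> \<epsilon> \<le> 1 \<and>
      (let U = unip M (opp e); K = {u\<in>U. mat_le av 1 u}; K' = {u\<in>U. near_one av \<epsilon> u} in
       (\<forall>n\<in>U. \<forall>k\<in>K'. \<forall>i. f (n * k * g, i) = f (n * g, i)) \<and>
       (\<forall>\<xi>. smooth_functional av (levi M e) \<sigma> \<xi> \<longrightarrow>
          ((\<lambda>c. \<xi> (\<lambda>i. f ((SOME n. n \<in> c) * g, i)) / of_nat (card (left_cosets K K'))) has_sum \<xi> v)
            (left_cosets U K'))))"

text \<open>
  The functions \<open>flat h s f\<close>, for \<open>h\<close> a smooth extension of a positive character \<open>D\<close> of the Levi
  subgroup and \<open>f\<close> in the representation induced from $\sigma$, run through the representation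
  induced from $\sigma \otimes D^s$.
\<close>

definition height :: "('f::field \<Rightarrow> real) \<Rightarrow> 'f mat set \<Rightarrow> (int \<Rightarrow> 'f mat) \<Rightarrow> ('f mat \<Rightarrow> real) \<Rightarrow> ('f mat \<Rightarrow> real) \<Rightarrow> bool"
  where "height av M e D h \<longleftrightarrow> (\<forall>g\<in>M. h g > 0) \<and>
    (\<forall>l\<in>levi M e. \<forall>u\<in>unip M e. \<forall>g\<in>M. h (l * u * g) = D l * h g) \<and>
    (\<exists>\<epsilon>>0. \<forall>g\<in>M. \<forall>k\<in>M. near_one av \<epsilon> k \<longrightarrow> h (g * k) = h g)"

definition flat :: "('f mat \<Rightarrow> real) \<Rightarrow> complex \<Rightarrow> ('f mat \<times> 'x \<Rightarrow> complex) \<Rightarrow> 'f mat \<times> 'x \<Rightarrow> complex"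
  where "flat h s f = (\<lambda>(g, i). of_real (h g) powr s * f (g, i))"

text \<open>
  Meromorphic continuation of the intertwining operators $J(\sigma \otimes D^s)$ from the parabolic
  subgroup given by \<open>e\<close> to the opposite one, which are given by integrals for \<open>sg * Re s\<close> large:
  \<open>R f\<close> lists pairs $(r, f')$ such that $J(\sigma \otimes D^s)$ maps \<open>flat h s f\<close> to
  $\sum r(s)\,\mathrm{flat}\,h'\,s\,f'$.
\<close>

definition intertwining_family :: "('f::field \<Rightarrow> real) \<Rightarrow> 'f mat set \<Rightarrow> (int \<Rightarrow> 'f mat) \<Rightarrow>
    ('f mat, 'x) rep \<Rightarrow> ('f mat \<Rightarrow> real) \<Rightarrow> ('f mat \<Rightarrow> real) \<Rightarrow> real \<Rightarrow>
    (('f mat \<times> 'x \<Rightarrow> complex) \<Rightarrow> ((complex \<Rightarrow> complex) \<times> ('f mat \<times> 'x \<Rightarrow> complex)) list) \<Rightarrow> bool"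
  where "intertwining_family av M e \<sigma> h h' sg R \<longleftrightarrow>
    (\<forall>f\<in>fst (induced av M e \<sigma>).
       (\<forall>(r, f')\<in>set (R f). r meromorphic_on UNIV \<and> f' \<in> fst (induced av M (opp e) \<sigma>)) \<and>
       (\<exists>s0. \<forall>s. sg * Re s > s0 \<longrightarrow> (\<forall>g\<in>M.
          intertwining_integral av M e \<sigma> (flat h s f) g
            (\<lambda>i. \<Sum>(r, f')\<leftarrow>R f. r s * flat h' s f' (g, i)))))"

text \<open>
  \<open>mu_inverse av M e \<sigma> j\<close>: the function $j(s)$ is $\mu(\sigma \otimes \delta_P^s)^{-1}$, that is,
  the scalar by which the composition of the two intertwining operators between the parabolic
  subgroups of \<open>M\<close> given by \<open>e\<close> and \<open>opp e\<close> acts (up to a non-zero constant, which does not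
  affect the zeros of $\mu$).
\<close>

definition mu_inverse :: "('f::field \<Rightarrow> real) \<Rightarrow> 'f mat set \<Rightarrow> (int \<Rightarrow> 'f mat) \<Rightarrow> ('f mat, 'x) rep \<Rightarrow>
    (complex \<Rightarrow> complex) \<Rightarrow> bool"
  where "mu_inverse av M e \<sigma> j \<longleftrightarrow> j meromorphic_on UNIV \<and>
    (\<exists>h h' R R'. height av M e (modulus av M e) h \<and> height av M (opp e) (modulus av M e) h' \<and>
       intertwining_family av M e \<sigma> h h' 1 R \<and> intertwining_family av M (opp e) \<sigma> h' h (-1) R' \<and>
       (\<forall>f\<in>fst (induced av M e \<sigma>). \<forall>x. fst x \<in> M \<longrightarrow>
          (\<forall>\<^sub>\<approx>s. (\<Sum>(r, f')\<leftarrow>R f. \<Sum>(r', f'')\<leftarrow>R' f'. r s * r' s * f'' x) = j s * f x)))"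

text \<open>The root system $\Sigma^{\mathfrak{t}}$: roots whose $\mu$-function has a zero on the orbit of
  $\sigma$ under unramified twists.\<close>

definition mu_roots :: "('f::field \<Rightarrow> real) \<Rightarrow> nat \<Rightarrow> 'f mat \<Rightarrow> 'f cusp_pair \<Rightarrow> ('f mat set \<times> 'f mat set) set"
  where "mu_roots av N B = (\<lambda>(L, \<sigma>). {(M, U). min_over N B L M \<and> U \<noteq> {1\<^sub>m N} \<and>
    (\<exists>e\<in>gradings_of N B M. levi M e = L \<and> unip M e = U \<and>
      (\<exists>\<kappa> j. unramified av N L \<kappa> \<and> mu_inverse av M e (twist \<kappa> \<sigma>) j \<and> is_pole j 0))})"


section \<open>The Hecke algebra of an inertial class\<close>

definition mult_set :: "'f::field mat set \<Rightarrow> 'f mat set \<Rightarrow> 'f mat set"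
  where "mult_set H K = {h * k | h k. h \<in> H \<and> k \<in> K}"

text \<open>The group $\mathrm{N}_G([L,\sigma]_L)$, the positive roots in $\Sigma^{\mathfrak{t}}$ with respect
  to the parabolic subgroup given by \<open>e\<close>, and the group $\mathfrak{R}^{\mathfrak{t}}$, a set of cosets
  of \<open>L\<close> with multiplication \<open>mult_set\<close>.\<close>

definition inertial_normalizer :: "('f::field \<Rightarrow> real) \<Rightarrow> nat \<Rightarrow> 'f mat \<Rightarrow> 'f cusp_pair \<Rightarrow> 'f mat set"
  where "inertial_normalizer av N B = (\<lambda>(L, \<sigma>). {g\<in>isom_group N B. conj_set g L = L \<and>
    (\<exists>\<kappa>. unramified av N L \<kappa> \<and> rep_iso L (conj_rep g \<sigma>) (twist \<kappa> \<sigma>))})"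

definition conj_root :: "'f::field mat \<Rightarrow> 'f mat set \<times> 'f mat set \<Rightarrow> 'f mat set \<times> 'f mat set"
  where "conj_root g = (\<lambda>(M, U). (conj_set g M, conj_set g U))"

definition positive_mu_roots :: "('f::field \<Rightarrow> real) \<Rightarrow> nat \<Rightarrow> 'f mat \<Rightarrow> 'f cusp_pair \<Rightarrow> (int \<Rightarrow> 'f mat) \<Rightarrow>
    ('f mat set \<times> 'f mat set) set"
  where "positive_mu_roots av N B D e = {(M, U) \<in> mu_roots av N B D. U \<subseteq> unip (isom_group N B) e}"

definition R_group :: "('f::field \<Rightarrow> real) \<Rightarrow> nat \<Rightarrow> 'f mat \<Rightarrow> 'f cusp_pair \<Rightarrow> (int \<Rightarrow> 'f mat) \<Rightarrow> 'f mat set set"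
  where "R_group av N B D e = {mult_set {g} (fst D) | g. g \<in> inertial_normalizer av N B D \<and>
    conj_root g ` positive_mu_roots av N B D e = positive_mu_roots av N B D e}"

text \<open>
  \<open>heiermann av N B t C Fo Fm\<close>: for a representative $(L,\sigma)$ of the inertial class \<open>t\<close> and a
  parabolic subgroup with Levi factor \<open>L\<close>, the algebra \<open>C\<close> is an extended affine Hecke algebra
  $\mathcal{H}(\mathcal{R},\lambda,\lambda^*,q) \rtimes \mathbb{C}[\mathfrak{R}^{\mathfrak{t}}]$ attached
  to \<open>t\<close>, and \<open>Fo, Fm\<close> is an equivalence of categories from the Bernstein block of \<open>t\<close> to the
  category of \<open>C\<close>-modules.  The map \<open>c\<close> identifies the root system of $\mathcal{R}$ with
  $\Sigma^{\mathfrak{t}}$, compatibly with positivity and with the Weyl groups: the reflection of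
  a root $(M, U)$ is represented by any element of $\mathrm{N}_M(L)$ outside \<open>L\<close>.
\<close>

definition heiermann :: "('f::field \<Rightarrow> real) \<Rightarrow> nat \<Rightarrow> 'f mat \<Rightarrow> 'f cusp_pair set \<Rightarrow> nat calg \<Rightarrow>
    (('f mat, nat) rep \<Rightarrow> (nat \<Rightarrow> complex, nat) rep) \<Rightarrow>
    (('f mat, nat) rep \<Rightarrow> ('f mat, nat) rep \<Rightarrow> ((nat \<Rightarrow> complex) \<Rightarrow> nat \<Rightarrow> complex) \<Rightarrow> (nat \<Rightarrow> complex) \<Rightarrow> nat \<Rightarrow> complex) \<Rightarrow>
    bool"
  where "heiermann av N B t C Fo Fm \<longleftrightarrow>
    (\<exists>L \<sigma> e D l ls q A \<theta> T c u.
      (L, \<sigma>) \<in> t \<and> grading N B e \<and> levi (isom_group N B) e = L \<and>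
      affine_hecke D l ls q A \<theta> T \<and>
      bij_betw c (roots D) (mu_roots av N B (L, \<sigma>)) \<and>
      (\<forall>\<alpha>\<in>roots D. positive_root D \<alpha> \<longleftrightarrow> c \<alpha> \<in> positive_mu_roots av N B (L, \<sigma>) e) \<and>
      (\<forall>\<alpha>\<in>roots D. \<forall>\<beta>\<in>roots D. \<forall>m\<in>fst (c \<alpha>). conj_set m L = L \<and> m \<notin> L \<longrightarrow>
         c (root_refl D \<alpha> \<beta>) = conj_root m (c \<beta>)) \<and>
      crossed_product A (R_group av N B (L, \<sigma>) e) mult_set L C u) \<and>
    cat_equivalence (isom_group N B) (bernstein_block av N B t) (alg_set C) (modules C) Fo Fm"


section \<open>The Weil representation\<close>

definition additive_character :: "('f::field \<Rightarrow> real) \<Rightarrow> ('f \<Rightarrow> complex) \<Rightarrow> bool"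
  where "additive_character av \<psi> \<longleftrightarrow> (\<forall>x. cmod (\<psi> x) = 1) \<and> (\<forall>x y. \<psi> (x + y) = \<psi> x * \<psi> y) \<and>
    (\<exists>\<epsilon>>0. \<forall>x. av x \<le> \<epsilon> \<longrightarrow> \<psi> x = 1) \<and> (\<exists>x. \<psi> x \<noteq> 1)"

text \<open>The discriminant of a form in \<open>2 * m\<close> variables, and the character of the multiplicative
  group associated with the extension by a square root of \<open>d\<close> (trivial exactly on the norms).\<close>

definition discriminant :: "nat \<Rightarrow> 'f::field mat \<Rightarrow> 'f"
  where "discriminant m Q = (-1) ^ m * Determinant.det Q"

definition quad_char :: "'f::field \<Rightarrow> 'f \<Rightarrow> complex"
  where "quad_char d x = (if \<exists>a b. x = a\<^sup>2 - d * b\<^sup>2 then 1 else -1)"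

text \<open>Let $W$ be symplectic of dimension \<open>2 * n\<close> with Lagrangian subspaces $X$ and $Y$ spanned by the
  first and the last \<open>n\<close> basis vectors, and let $V = F^m$ with Gram matrix \<open>Q\<close>.  Elements of
  $W \otimes V$ are \<open>m\<close> by \<open>2 * n\<close> matrices, their \<open>j\<close>-th column being the coefficient in \<open>V\<close> of the
  \<open>j\<close>-th basis vector of \<open>W\<close>; $(g, h)$ acts by $w \mapsto h w g^T$.  The function
  \<open>form_XY\<close> is the symplectic form on pairs from $X \otimes V$ and $Y \otimes V$.\<close>

definition form_XY :: "nat \<Rightarrow> 'f::field mat \<Rightarrow> 'f mat \<Rightarrow> 'f mat \<Rightarrow> 'f"
  where "form_XY n Q x y = (\<Sum>i<n. (transpose_mat x * Q * y) $$ (i, i))"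

definition X_part :: "nat \<Rightarrow> 'f mat \<Rightarrow> 'f mat"
  where "X_part n w = Matrix.mat (dim_row w) n (\<lambda>(i, j). w $$ (i, j))"

definition Y_part :: "nat \<Rightarrow> 'f mat \<Rightarrow> 'f mat"
  where "Y_part n w = Matrix.mat (dim_row w) n (\<lambda>(i, j). w $$ (i, n + j))"

text \<open>The Schwartz space of $X \otimes V$, and on it the Schroedinger model of the representation of
  the Heisenberg group of $W \otimes V$ with central character \<open>\<psi>\<close>, restricted to $W \otimes V$.\<close>

definition schwartz :: "('f::field \<Rightarrow> real) \<Rightarrow> nat \<Rightarrow> nat \<Rightarrow> ('f mat \<Rightarrow> complex) set"
  where "schwartz av m n = {\<phi>. (\<forall>x. x \<notin> carrier_mat m n \<longrightarrow> \<phi> x = 0) \<and>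
    (\<exists>r. \<forall>x\<in>carrier_mat m n. \<phi> x \<noteq> 0 \<longrightarrow> mat_le av r x) \<and>
    (\<exists>\<epsilon>>0. \<forall>x\<in>carrier_mat m n. \<forall>y\<in>carrier_mat m n. mat_le av \<epsilon> y \<longrightarrow> \<phi> (x + y) = \<phi> x)}"

definition heisenberg :: "nat \<Rightarrow> nat \<Rightarrow> 'f::field mat \<Rightarrow> ('f \<Rightarrow> complex) \<Rightarrow> 'f mat \<Rightarrow>
    ('f mat \<Rightarrow> complex) \<Rightarrow> 'f mat \<Rightarrow> complex"
  where "heisenberg m n Q \<psi> w \<phi> = (\<lambda>z. if z \<in> carrier_mat m n
    then \<psi> (form_XY n Q z (Y_part n w) + form_XY n Q (X_part n w) (Y_part n w) / 2) * \<phi> (z + X_part n w)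
    else 0)"

text \<open>
  \<open>\<omega> g h\<close> is the operator of $(g, h)$ in the Weil representation of $\mathrm{Sp}(W) \times
  \mathrm{O}(V)$, where \<open>dim V = 2 * n'\<close>.  The third clause says that $((g,h), \omega(g,h))$ belongs
  to the metaplectic group of $W \otimes V$, realized as the group of pairs $(x, A)$ with
  $A\,\rho_\psi(w) = \rho_\psi(x w)\,A$, in which the Weil representation is $(x, A) \mapsto A$.  So
  \<open>\<omega>\<close> is the pullback of the Weil representation by a splitting, and the last three clauses are
  the values of Kudla's splitting on $\mathrm{O}(V)$ and on the Siegel parabolic subgroup (Levi
  factor and unipotent radical) in the Schroedinger model.  They determine it: two splittings differ
  by a character, and $\mathrm{Sp}(W)$ is perfect.
\<close>

definition weil_rep :: "('f::field \<Rightarrow> real) \<Rightarrow> ('f \<Rightarrow> complex) \<Rightarrow> nat \<Rightarrow> nat \<Rightarrow> 'f mat \<Rightarrow>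
    ('f mat \<Rightarrow> 'f mat \<Rightarrow> ('f mat \<Rightarrow> complex) \<Rightarrow> 'f mat \<Rightarrow> complex) \<Rightarrow> bool"
  where "weil_rep av \<psi> n n' Q \<omega> \<longleftrightarrow>
    (let G = Sp n; G' = isom_group (2 * n') Q; S = schwartz av (2 * n') n in
     (\<forall>g\<in>G. \<forall>h\<in>G'. lin_on S S (\<omega> g h)) \<and>
     (\<forall>g1\<in>G. \<forall>g2\<in>G. \<forall>h1\<in>G'. \<forall>h2\<in>G'. \<forall>\<phi>\<in>S. \<omega> (g1 * g2) (h1 * h2) \<phi> = \<omega> g1 h1 (\<omega> g2 h2 \<phi>)) \<and>
     (\<forall>g\<in>G. \<forall>h\<in>G'. \<forall>w\<in>carrier_mat (2 * n') (2 * n). \<forall>\<phi>\<in>S.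
        \<omega> g h (heisenberg (2 * n') n Q \<psi> w \<phi>) =
        heisenberg (2 * n') n Q \<psi> (h * w * transpose_mat g) (\<omega> g h \<phi>)) \<and>
     (\<forall>h\<in>G'. \<forall>\<phi>\<in>S. \<forall>x\<in>carrier_mat (2 * n') n. \<omega> (1\<^sub>m (2 * n)) h \<phi> x = \<phi> (mat_inv h * x)) \<and>
     (\<forall>a\<in>carrier_mat n n. Determinant.det a \<noteq> 0 \<longrightarrow> (\<forall>\<phi>\<in>S. \<forall>x\<in>carrier_mat (2 * n') n.
        \<omega> (four_block_mat a (0\<^sub>m n n) (0\<^sub>m n n) (transpose_mat (mat_inv a))) (1\<^sub>m (2 * n')) \<phi> x =
        quad_char (discriminant n' Q) (Determinant.det a) * of_real (inverse (av (Determinant.det a)) ^ n') *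
        \<phi> (x * transpose_mat (mat_inv a)))) \<and>
     (\<forall>b\<in>carrier_mat n n. transpose_mat b = b \<longrightarrow> (\<forall>\<phi>\<in>S. \<forall>x\<in>carrier_mat (2 * n') n.
        \<omega> (four_block_mat (1\<^sub>m n) (0\<^sub>m n n) b (1\<^sub>m n)) (1\<^sub>m (2 * n')) \<phi> x =
        \<psi> (- (form_XY n Q x (x * b) / 2)) * \<phi> x)))"


section \<open>Theta lifts\<close>

text \<open>The algebraic tensor product of two spaces of functions, realized inside the functions on the
  product; operators act on one factor through the slices.\<close>

definition tensor :: "('x \<Rightarrow> complex) set \<Rightarrow> ('y \<Rightarrow> complex) set \<Rightarrow> ('x \<times> 'y \<Rightarrow> complex) set"
  where "tensor V W = cfun.span {(\<lambda>(i, j). v i * w j) | v w. v \<in> V \<and> w \<in> W}"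

definition act_left :: "(('x \<Rightarrow> complex) \<Rightarrow> 'x \<Rightarrow> complex) \<Rightarrow> ('x \<times> 'y \<Rightarrow> complex) \<Rightarrow> 'x \<times> 'y \<Rightarrow> complex"
  where "act_left f z = (\<lambda>(i, j). f (\<lambda>i'. z (i', j)) i)"

definition act_right :: "(('y \<Rightarrow> complex) \<Rightarrow> 'y \<Rightarrow> complex) \<Rightarrow> ('x \<times> 'y \<Rightarrow> complex) \<Rightarrow> 'x \<times> 'y \<Rightarrow> complex"
  where "act_right f z = (\<lambda>(i, j). f (\<lambda>j'. z (i, j')) j)"

text \<open>
  \<open>big_theta G H S \<omega> \<pi> \<Theta>\<close>: the representation $\Theta$ of \<open>H\<close> is the big theta lift of
  $\pi$, that is, the quotient of \<open>\<omega>\<close> (on the space \<open>S\<close>) by the common kernel of all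
  \<open>G\<close>-maps from \<open>\<omega>\<close> to $\pi$ is isomorphic to $\pi \otimes \Theta$.
\<close>

definition big_theta :: "'g set \<Rightarrow> 'f::field mat set \<Rightarrow> nat \<Rightarrow> ('s \<Rightarrow> complex) set \<Rightarrow>
    ('g \<Rightarrow> 'f mat \<Rightarrow> ('s \<Rightarrow> complex) \<Rightarrow> 's \<Rightarrow> complex) \<Rightarrow> ('g, nat) rep \<Rightarrow> ('f mat, nat) rep \<Rightarrow> bool"
  where "big_theta G H M S \<omega> \<pi> \<Theta> \<longleftrightarrow> monoid_rep H (*) (1\<^sub>m M) \<Theta> \<and>
    (\<exists>p. lin_on S (tensor (fst \<pi>) (fst \<Theta>)) p \<and> p ` S = tensor (fst \<pi>) (fst \<Theta>) \<and>
      (\<forall>g\<in>G. \<forall>h\<in>H. \<forall>\<phi>\<in>S. p (\<omega> g h \<phi>) = act_left (snd \<pi> g) (act_right (snd \<Theta> h) (p \<phi>))) \<and>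
      {\<phi>\<in>S. p \<phi> = 0} = {\<phi>\<in>S. \<forall>f\<in>Homs G (S, \<lambda>g. \<omega> g (1\<^sub>m M)) \<pi>. f \<phi> = 0})"

text \<open>The dual pair $(\mathrm{Sp}_{2n}(F), \mathrm{O}(V))$ with \<open>V\<close> of dimension \<open>2 * n'\<close> and Gram
  matrix \<open>Q\<close>.\<close>

definition Theta_lift :: "('f::field \<Rightarrow> real) \<Rightarrow> nat \<Rightarrow> nat \<Rightarrow> 'f mat \<Rightarrow>
    ('f mat \<Rightarrow> 'f mat \<Rightarrow> ('f mat \<Rightarrow> complex) \<Rightarrow> 'f mat \<Rightarrow> complex) \<Rightarrow>
    ('f mat, nat) rep \<Rightarrow> ('f mat, nat) rep \<Rightarrow> bool"
  where "Theta_lift av n n' Q \<omega> \<pi> \<Theta> \<longleftrightarrow>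
    big_theta (Sp n) (isom_group (2 * n') Q) (2 * n') (schwartz av (2 * n') n) \<omega> \<pi> \<Theta>"

definition Theta_nonzero :: "('f::field \<Rightarrow> real) \<Rightarrow> nat \<Rightarrow> nat \<Rightarrow> 'f mat \<Rightarrow>
    ('f mat \<Rightarrow> 'f mat \<Rightarrow> ('f mat \<Rightarrow> complex) \<Rightarrow> 'f mat \<Rightarrow> complex) \<Rightarrow> ('f mat, nat) rep \<Rightarrow> bool"
  where "Theta_nonzero av n n' Q \<omega> \<pi> \<longleftrightarrow> (\<exists>\<Theta>. Theta_lift av n n' Q \<omega> \<pi> \<Theta> \<and> fst \<Theta> \<noteq> {0})"

text \<open>\<open>small_theta av n n' Q \<omega> \<pi> \<pi>'\<close>: the representation \<open>\<pi>'\<close> is (isomorphic to) the small theta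
  lift of \<open>\<pi>\<close>.\<close>

definition small_theta :: "('f::field \<Rightarrow> real) \<Rightarrow> nat \<Rightarrow> nat \<Rightarrow> 'f mat \<Rightarrow>
    ('f mat \<Rightarrow> 'f mat \<Rightarrow> ('f mat \<Rightarrow> complex) \<Rightarrow> 'f mat \<Rightarrow> complex) \<Rightarrow>
    ('f mat, nat) rep \<Rightarrow> ('f mat, nat) rep \<Rightarrow> bool"
  where "small_theta av n n' Q \<omega> \<pi> \<pi>' \<longleftrightarrow> \<pi>' \<in> Irr_smooth av (2 * n') (isom_group (2 * n') Q) \<and>
    (\<exists>\<Theta>. Theta_lift av n n' Q \<omega> \<pi> \<Theta> \<and> is_quotient (isom_group (2 * n') Q) \<Theta> \<pi>')"

text \<open>Howe duality: a non-zero big theta lift has a unique irreducible quotient, and non-isomorphic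
  representations have non-isomorphic small theta lifts.\<close>

definition howe_duality :: "('f::field \<Rightarrow> real) \<Rightarrow> nat \<Rightarrow> nat \<Rightarrow> 'f mat \<Rightarrow>
    ('f mat \<Rightarrow> 'f mat \<Rightarrow> ('f mat \<Rightarrow> complex) \<Rightarrow> 'f mat \<Rightarrow> complex) \<Rightarrow> bool"
  where "howe_duality av n n' Q \<omega> \<longleftrightarrow>
    (let G = Sp n; G' = isom_group (2 * n') Q in
     (\<forall>\<pi>\<in>Irr_smooth av (2 * n) G.
        (\<exists>\<Theta>. Theta_lift av n n' Q \<omega> \<pi> \<Theta>) \<and>
        (Theta_nonzero av n n' Q \<omega> \<pi> \<longrightarrow> (\<exists>\<pi>'. small_theta av n n' Q \<omega> \<pi> \<pi>')) \<and>
        (\<forall>\<pi>' \<pi>''. small_theta av n n' Q \<omega> \<pi> \<pi>' \<and> small_theta av n n' Q \<omega> \<pi> \<pi>'' \<longrightarrow>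
           rep_iso G' \<pi>' \<pi>'')) \<and>
     (\<forall>\<pi>1\<in>Irr_smooth av (2 * n) G. \<forall>\<pi>2\<in>Irr_smooth av (2 * n) G. \<forall>\<pi>1' \<pi>2'.
        small_theta av n n' Q \<omega> \<pi>1 \<pi>1' \<and> small_theta av n n' Q \<omega> \<pi>2 \<pi>2' \<and> rep_iso G' \<pi>1' \<pi>2' \<longrightarrow>
          rep_iso G \<pi>1 \<pi>2))"

text \<open>The inertial class \<open>\<theta>(s)\<close>: the one that contains the supercuspidal supports of the
  small theta lifts of the irreducible representations in the Bernstein block of \<open>s\<close>.  It is
  meaningful if at least one of these lifts is non-zero; that it is then unique is the theorem
  of Kudla expressed by \<open>kudla_blocks\<close>.\<close>

definition theta_class :: "('f::field \<Rightarrow> real) \<Rightarrow> nat \<Rightarrow> nat \<Rightarrow> 'f mat \<Rightarrow>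
    ('f mat \<Rightarrow> 'f mat \<Rightarrow> ('f mat \<Rightarrow> complex) \<Rightarrow> 'f mat \<Rightarrow> complex) \<Rightarrow> 'f cusp_pair set \<Rightarrow> 'f cusp_pair set"
  where "theta_class av n n' Q \<omega> s = (THE t. t \<in> bernstein av (2 * n') Q \<and>
    (\<exists>\<pi>\<in>Irr_block av (2 * n) (symplectic_form n) s. \<exists>\<pi>'. small_theta av n n' Q \<omega> \<pi> \<pi>' \<and>
       supp av (2 * n') Q \<pi>' \<noteq> {} \<and> supp av (2 * n') Q \<pi>' \<subseteq> t))"

definition kudla_blocks :: "('f::field \<Rightarrow> real) \<Rightarrow> nat \<Rightarrow> nat \<Rightarrow> 'f mat \<Rightarrow>
    ('f mat \<Rightarrow> 'f mat \<Rightarrow> ('f mat \<Rightarrow> complex) \<Rightarrow> 'f mat \<Rightarrow> complex) \<Rightarrow> bool"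
  where "kudla_blocks av n n' Q \<omega> \<longleftrightarrow>
    (\<forall>s\<in>bernstein av (2 * n) (symplectic_form n). \<exists>t\<in>bernstein av (2 * n') Q.
       \<forall>\<pi>\<in>Irr_block av (2 * n) (symplectic_form n) s. \<forall>\<pi>'. small_theta av n n' Q \<omega> \<pi> \<pi>' \<longrightarrow>
         supp av (2 * n') Q \<pi>' \<noteq> {} \<and> supp av (2 * n') Q \<pi>' \<subseteq> t)"

end

theory Submission
  imports Defs
begin

text \<open>
  An equivalence of categories identifies irreducible objects and isomorphism classes on both
  sides, so by Heiermann's theorem the correspondence may be transported from irreducible
  representations to simple modules.  On representations, Kudla's theorem confines the small theta
  lifts of a Bernstein block to the block of one inertial class; it is unique, hence equal to
  $\theta(\mathfrak{s})$, because inertial equivalence is an equivalence relation.  Howe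
  duality makes the resulting map of isomorphism classes well defined and injective, once one knows
  that the big theta lift depends only on the isomorphism class.
\<close>

section \<open>Intertwining maps\<close>

text \<open>The functor in \<open>cat_equivalence\<close> is fully faithful and essentially
  surjective, but neither additivity nor exactness is given. Whatever is transported is therefore
  phrased through composition and identities: isomorphism as a pair of mutually inverse morphisms, a
  zero object as one with a single endomorphism, injectivity through kernels that are themselves
  objects. Both sides are closed under subobjects, while quotients have no ready model as spaces of
  functions. Groups and algebras share one theory, built on what their representations have in
  common: \<open>stable_rep\<close>, a linear subspace preserved by linear operators. The other
  obstacle is that inertial equivalence involves a conjugation and a twist at once. Composing two
  such relations moves an unramified character from one Levi subgroup to a conjugate one, so
  conjugates of compact subgroups must be shown compact. If no member of the block has a non-zero
  lift, \<open>theta_class\<close> is a description without a guaranteed referent; source and target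
  of the correspondence are then both empty.\<close>

definition stable_rep :: "'g set \<Rightarrow> ('g, 'x) rep \<Rightarrow> bool"
  where "stable_rep S \<pi> \<longleftrightarrow> cfun.subspace (fst \<pi>) \<and> (\<forall>a\<in>S. lin_on (fst \<pi>) (fst \<pi>) (snd \<pi> a))"

text \<open>The identity morphism under the convention of \<open>Homs\<close>: zero outside the
  source, hence the same function that \<open>cat_equivalence\<close> treats as the
  identity.\<close>

definition id_hom :: "('g, 'x) rep \<Rightarrow> ('x \<Rightarrow> complex) \<Rightarrow> 'x \<Rightarrow> complex"
  where "id_hom \<pi> = (\<lambda>v. if v \<in> fst \<pi> then v else 0)"

lemma monoid_rep_stable: "monoid_rep S mul e \<pi> \<Longrightarrow> stable_rep S \<pi>"
  by (auto simp: monoid_rep_def stable_rep_def)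

lemma smooth_rep_stable: "smooth_rep av N G \<pi> \<Longrightarrow> stable_rep G \<pi>"
  by (auto simp: smooth_rep_def intro: monoid_rep_stable)

lemma modules_stable: "M \<in> modules A \<Longrightarrow> stable_rep (alg_set A) M"
  by (auto simp: modules_def intro: monoid_rep_stable)

lemma smul_zero_left [simp]: "smul 0 v = 0"
  by (auto simp: smul_def fun_eq_iff)

lemma lin_on_zero: "lin_on V W f \<Longrightarrow> 0 \<in> V \<Longrightarrow> f 0 = 0"
  unfolding lin_on_def by (metis smul_zero_left)

lemma lin_on_compose: "lin_on U V f \<Longrightarrow> lin_on V W g \<Longrightarrow> lin_on U W (\<lambda>v. g (f v))"
  by (auto simp: lin_on_def)

lemma stable_rep_zero: "stable_rep S \<pi> \<Longrightarrow> 0 \<in> fst \<pi>"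
  by (auto simp: stable_rep_def cfun.subspace_def)

lemma stable_rep_act: "stable_rep S \<pi> \<Longrightarrow> a \<in> S \<Longrightarrow> v \<in> fst \<pi> \<Longrightarrow> snd \<pi> a v \<in> fst \<pi>"
  by (auto simp: stable_rep_def lin_on_def)

lemma Homs_in: "f \<in> Homs S \<pi> \<rho> \<Longrightarrow> v \<in> fst \<pi> \<Longrightarrow> f v \<in> fst \<rho>"
  by (auto simp: Homs_def lin_on_def)

lemma Homs_act: "f \<in> Homs S \<pi> \<rho> \<Longrightarrow> a \<in> S \<Longrightarrow> v \<in> fst \<pi> \<Longrightarrow> f (snd \<pi> a v) = snd \<rho> a (f v)"
  by (auto simp: Homs_def)

lemma Homs_add: "f \<in> Homs S \<pi> \<rho> \<Longrightarrow> u \<in> fst \<pi> \<Longrightarrow> v \<in> fst \<pi> \<Longrightarrow> f (u + v) = f u + f v"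
  by (auto simp: Homs_def lin_on_def)

lemma Homs_scale: "f \<in> Homs S \<pi> \<rho> \<Longrightarrow> v \<in> fst \<pi> \<Longrightarrow> f (smul c v) = smul c (f v)"
  by (auto simp: Homs_def lin_on_def)

lemma Homs_outside: "f \<in> Homs S \<pi> \<rho> \<Longrightarrow> v \<notin> fst \<pi> \<Longrightarrow> f v = 0"
  by (auto simp: Homs_def)

text \<open>If 0 lies in the source, linearity decides; if not, the convention outside the source
  does. This keeps composites zero outside their source.\<close>

lemma Homs_0: "f \<in> Homs S \<pi> \<rho> \<Longrightarrow> f 0 = 0"
  by (cases "0 \<in> fst \<pi>") (auto simp: Homs_def intro: lin_on_zero)

lemma Homs_comp:
  assumes f: "f \<in> Homs S \<pi> \<rho>" and g: "g \<in> Homs S \<rho> \<tau>"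
  shows "g \<circ> f \<in> Homs S \<pi> \<tau>"
  using f g Homs_0[OF g] by (auto simp: Homs_def lin_on_def)

lemma id_hom_Homs: "stable_rep S \<pi> \<Longrightarrow> id_hom \<pi> \<in> Homs S \<pi> \<pi>"
  by (auto simp: Homs_def id_hom_def lin_on_def stable_rep_def
      intro: cfun.subspace_add cfun.subspace_scale)

lemma zero_Homs:
  assumes "stable_rep S \<pi>" "stable_rep S \<rho>" shows "(\<lambda>v. 0) \<in> Homs S \<pi> \<rho>"
proof -
  have "snd \<rho> a 0 = 0" if "a \<in> S" for a
    using assms(2) that by (auto simp: stable_rep_def intro: lin_on_zero cfun.subspace_0)
  then show ?thesis
    using stable_rep_zero[OF assms(2)] by (auto simp: Homs_def lin_on_def)
qed

text \<open>Injectivity of \<open>f\<close> turns its linearity and equivariance into those of the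
  inverse. The inverse is extended by zero, so that both composites are identity morphisms as
  functions on the whole type.\<close>

lemma inverse_Homs:
  assumes "stable_rep S \<pi>" and f: "f \<in> Homs S \<pi> \<rho>" and bij: "bij_betw f (fst \<pi>) (fst \<rho>)"
  shows "\<exists>g\<in>Homs S \<rho> \<pi>. g \<circ> f = id_hom \<pi> \<and> f \<circ> g = id_hom \<rho>"
proof -
  define g where "g = (\<lambda>w. if w \<in> fst \<rho> then inv_into (fst \<pi>) f w else 0)"
  have gf: "g (f v) = v" if "v \<in> fst \<pi>" for v
    using that bij Homs_in[OF f that] by (simp add: g_def bij_betw_def)
  have fg: "f (g w) = w" and gin: "g w \<in> fst \<pi>" if "w \<in> fst \<rho>" for w
    using that bij by (auto simp: g_def bij_betw_def f_inv_into_f inv_into_into)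
  have V: "cfun.subspace (fst \<pi>)"
    using assms(1) by (simp add: stable_rep_def)
  have "g \<in> Homs S \<rho> \<pi>"
    unfolding Homs_def lin_on_def
  proof (safe)
    fix u v assume uv: "u \<in> fst \<rho>" "v \<in> fst \<rho>"
    have "g u + g v \<in> fst \<pi>"
      using V gin uv by (blast intro: cfun.subspace_add)
    moreover have "f (g u + g v) = u + v"
      using Homs_add[OF f gin gin] uv fg by simp
    ultimately show "g (u + v) = g u + g v"
      using gf by metis
  next
    fix c v assume v: "v \<in> fst \<rho>"
    have "smul c (g v) \<in> fst \<pi>"
      using V gin v by (blast intro: cfun.subspace_scale)
    moreover have "f (smul c (g v)) = smul c v"
      using Homs_scale[OF f gin] v fg by simp
    ultimately show "g (smul c v) = smul c (g v)"
      using gf by metis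
  next
    fix a v assume a: "a \<in> S" and v: "v \<in> fst \<rho>"
    have "f (snd \<pi> a (g v)) = snd \<rho> a v"
      using Homs_act[OF f a gin] v fg by simp
    then show "g (snd \<rho> a v) = snd \<pi> a (g v)"
      using gf stable_rep_act[OF assms(1) a gin[OF v]] by metis
  qed (auto simp: gin, auto simp: g_def)
  moreover have "g \<circ> f = id_hom \<pi>"
  proof
    fix v show "(g \<circ> f) v = id_hom \<pi> v"
      using gf Homs_outside[OF f, of v] gf[OF stable_rep_zero[OF assms(1)]] Homs_0[OF f]
      by (cases "v \<in> fst \<pi>") (auto simp: id_hom_def)
  qed
  moreover have "f \<circ> g = id_hom \<rho>"
  proof
    fix w show "(f \<circ> g) w = id_hom \<rho> w"
      using fg Homs_0[OF f] by (cases "w \<in> fst \<rho>") (auto simp: id_hom_def g_def)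
  qed
  ultimately show ?thesis
    by blast
qed

text \<open>Bijectivity of a map is invisible to an abstract functor. A two-sided inverse is a
  matter of equations between morphisms, which a fully faithful functor preserves and
  reflects.\<close>

lemma rep_iso_iff:
  assumes "stable_rep S \<pi>" "stable_rep S \<rho>"
  shows "rep_iso S \<pi> \<rho> \<longleftrightarrow>
    (\<exists>f\<in>Homs S \<pi> \<rho>. \<exists>g\<in>Homs S \<rho> \<pi>. g \<circ> f = id_hom \<pi> \<and> f \<circ> g = id_hom \<rho>)"
proof
  assume "rep_iso S \<pi> \<rho>"
  then show "\<exists>f\<in>Homs S \<pi> \<rho>. \<exists>g\<in>Homs S \<rho> \<pi>. g \<circ> f = id_hom \<pi> \<and> f \<circ> g = id_hom \<rho>"
    using inverse_Homs[OF assms(1)] by (metis rep_iso_def)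
next
  assume "\<exists>f\<in>Homs S \<pi> \<rho>. \<exists>g\<in>Homs S \<rho> \<pi>. g \<circ> f = id_hom \<pi> \<and> f \<circ> g = id_hom \<rho>"
  then obtain f g where f: "f \<in> Homs S \<pi> \<rho>" and g: "g \<in> Homs S \<rho> \<pi>"
    and gf: "g \<circ> f = id_hom \<pi>" and fg: "f \<circ> g = id_hom \<rho>"
    by blast
  have "g (f v) = v" if "v \<in> fst \<pi>" for v
    using fun_cong[OF gf, of v] that by (simp add: id_hom_def)
  moreover have "f (g w) = w" if "w \<in> fst \<rho>" for w
    using fun_cong[OF fg, of w] that by (simp add: id_hom_def)
  ultimately have "bij_betw f (fst \<pi>) (fst \<rho>)"
    using Homs_in[OF f] Homs_in[OF g] by (intro bij_betw_byWitness[where f' = g]) auto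
  then show "rep_iso S \<pi> \<rho>"
    using f by (auto simp: rep_iso_def)
qed

section \<open>Isomorphism as an equivalence relation, and isomorphism classes\<close>

lemma rep_iso_refl: "stable_rep S \<pi> \<Longrightarrow> rep_iso S \<pi> \<pi>"
  unfolding rep_iso_def
  by (rule bexI[OF _ id_hom_Homs]) (auto simp: bij_betw_def inj_on_def id_hom_def)

lemma rep_iso_sym: "stable_rep S \<pi> \<Longrightarrow> stable_rep S \<rho> \<Longrightarrow> rep_iso S \<pi> \<rho> \<Longrightarrow> rep_iso S \<rho> \<pi>"
  by (metis rep_iso_iff)

lemma rep_iso_trans: "rep_iso S \<pi> \<rho> \<Longrightarrow> rep_iso S \<rho> \<tau> \<Longrightarrow> rep_iso S \<pi> \<tau>"
  unfolding rep_iso_def by (meson Homs_comp bij_betw_trans)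

lemma iso_class_eq_iff:
  assumes "\<And>\<rho>. \<rho> \<in> C \<Longrightarrow> stable_rep S \<rho>" and "\<pi>1 \<in> C" "\<pi>2 \<in> C"
  shows "iso_class S C \<pi>1 = iso_class S C \<pi>2 \<longleftrightarrow> rep_iso S \<pi>1 \<pi>2"
proof
  assume "iso_class S C \<pi>1 = iso_class S C \<pi>2"
  moreover have "\<pi>2 \<in> iso_class S C \<pi>2"
    using rep_iso_refl[OF assms(1)] assms by (simp add: iso_class_def)
  ultimately show "rep_iso S \<pi>1 \<pi>2"
    by (auto simp: iso_class_def)
next
  assume iso: "rep_iso S \<pi>1 \<pi>2"
  then have "rep_iso S \<pi>2 \<pi>1"
    by (rule rep_iso_sym[OF assms(1)[OF assms(2)] assms(1)[OF assms(3)]])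
  then show "iso_class S C \<pi>1 = iso_class S C \<pi>2"
    using rep_iso_trans[OF iso] rep_iso_trans[of S \<pi>2 \<pi>1] by (auto simp: iso_class_def)
qed

lemma is_quotient_iso:
  assumes "is_quotient S \<pi> \<rho>" "rep_iso S \<rho> \<rho>'" shows "is_quotient S \<pi> \<rho>'"
proof -
  obtain f g where f: "f \<in> Homs S \<pi> \<rho>" "f ` fst \<pi> = fst \<rho>" and g: "g \<in> Homs S \<rho> \<rho>'" "g ` fst \<rho> = fst \<rho>'"
    using assms by (auto simp: is_quotient_def rep_iso_def bij_betw_def)
  then have "(g \<circ> f) ` fst \<pi> = fst \<rho>'"
    by (simp only: image_comp[symmetric])
  then show ?thesis
    unfolding is_quotient_def using Homs_comp[OF f(1) g(1)] by blast
qed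

lemma is_subquotient_iso:
  "is_subquotient S \<pi> \<rho> \<Longrightarrow> rep_iso S \<rho> \<rho>' \<Longrightarrow> is_subquotient S \<pi> \<rho>'"
  unfolding is_subquotient_def by (blast intro: is_quotient_iso)

section \<open>Kernels, images and subrepresentations\<close>

lemma kernel_invariant:
  assumes "stable_rep S \<pi>" "stable_rep S \<rho>" and f: "f \<in> Homs S \<pi> \<rho>"
  shows "invariant_subspace S \<pi> {v \<in> fst \<pi>. f v = 0}"
proof -
  have "snd \<rho> a 0 = 0" if "a \<in> S" for a
    using assms(2) that by (auto simp: stable_rep_def intro: lin_on_zero cfun.subspace_0)
  then show ?thesis
    using assms(1) Homs_0[OF f] Homs_add[OF f] Homs_scale[OF f] Homs_act[OF f] stable_rep_act[OF assms(1)]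
    by (auto simp: invariant_subspace_def stable_rep_def cfun.subspace_def)
qed

lemma image_invariant:
  assumes "stable_rep S \<pi>" and f: "f \<in> Homs S \<pi> \<rho>"
  shows "invariant_subspace S \<rho> (f ` fst \<pi>)"
proof -
  have V: "cfun.subspace (fst \<pi>)"
    using assms(1) by (simp add: stable_rep_def)
  have "f u + f v \<in> f ` fst \<pi>" if "u \<in> fst \<pi>" "v \<in> fst \<pi>" for u v
    using that Homs_add[OF f that] V by (metis cfun.subspace_add imageI)
  moreover have "smul c (f v) \<in> f ` fst \<pi>" if "v \<in> fst \<pi>" for c v
    using that Homs_scale[OF f that] V by (metis cfun.subspace_scale imageI)
  moreover have "0 \<in> f ` fst \<pi>"
    using Homs_0[OF f] cfun.subspace_0[OF V] by force
  moreover have "snd \<rho> a (f v) \<in> f ` fst \<pi>" if "a \<in> S" "v \<in> fst \<pi>" for a v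
    using Homs_act[OF f that] stable_rep_act[OF assms(1) that] by (metis imageI)
  ultimately show ?thesis
    using Homs_in[OF f] by (auto simp: invariant_subspace_def cfun.subspace_def)
qed

lemma injective_Homs:
  assumes "stable_rep S \<pi>" and f: "f \<in> Homs S \<pi> \<rho>" and ker: "\<And>v. v \<in> fst \<pi> \<Longrightarrow> f v = 0 \<Longrightarrow> v = 0"
  shows "inj_on f (fst \<pi>)"
proof (rule inj_onI)
  fix u v assume uv: "u \<in> fst \<pi>" "v \<in> fst \<pi>" and eq: "f u = f v"
  have V: "cfun.subspace (fst \<pi>)"
    using assms(1) by (simp add: stable_rep_def)
  have d: "u - v \<in> fst \<pi>"
    using V uv by (rule cfun.subspace_diff)
  have "f u = f (u - v) + f v"
    using Homs_add[OF f d uv(2)] by simp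
  then have "u - v = 0"
    using eq d by (intro ker) auto
  then show "u = v" by simp
qed

lemma subrep_stable:
  assumes "stable_rep S \<pi>" "invariant_subspace S \<pi> U" shows "stable_rep S (U, snd \<pi>)"
  using assms by (auto simp: stable_rep_def invariant_subspace_def lin_on_def subset_iff)

lemma inclusion_Homs:
  assumes "stable_rep S \<pi>" "invariant_subspace S \<pi> U" shows "id_hom (U, snd \<pi>) \<in> Homs S (U, snd \<pi>) \<pi>"
  using id_hom_Homs[OF subrep_stable[OF assms]] assms(2)
  by (auto simp: Homs_def lin_on_def invariant_subspace_def)

text \<open>Schur's argument: a subspace mapping onto the non-zero space of \<rho> cannot be zero,
  so it is all of \<pi>; the kernel is then proper, hence zero.\<close>

lemma irreducible_subquotient_iso:
  assumes irr: "irreducible_rep S \<pi>" and st: "stable_rep S \<pi>"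
    and irr': "irreducible_rep S \<rho>" and st': "stable_rep S \<rho>" and sub: "is_subquotient S \<pi> \<rho>"
  shows "rep_iso S \<pi> \<rho>"
proof -
  obtain U f where U: "invariant_subspace S \<pi> U" and f: "f \<in> Homs S (U, snd \<pi>) \<rho>" and im: "f ` U = fst \<rho>"
    using sub by (auto simp: is_subquotient_def is_quotient_def)
  have nz: "fst \<rho> \<noteq> {0}"
    using irr' by (simp add: irreducible_rep_def)
  have "U \<noteq> {0}"
    using im nz Homs_0[OF f] by auto
  then have "U = fst \<pi>"
    using irr U by (auto simp: irreducible_rep_def)
  then have f: "f \<in> Homs S \<pi> \<rho>" and im: "f ` fst \<pi> = fst \<rho>"
    using f im by auto
  have "{v \<in> fst \<pi>. f v = 0} \<noteq> fst \<pi>"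
  proof
    assume "{v \<in> fst \<pi>. f v = 0} = fst \<pi>"
    then have "f ` fst \<pi> \<subseteq> {0}" by blast
    then show False
      using im nz stable_rep_zero[OF st'] by blast
  qed
  then have "{v \<in> fst \<pi>. f v = 0} = {0}"
    using irr kernel_invariant[OF st st' f] by (auto simp: irreducible_rep_def)
  then have "inj_on f (fst \<pi>)"
    by (intro injective_Homs[OF st f]) blast
  then show ?thesis
    using f im by (auto simp: rep_iso_def bij_betw_def)
qed


section \<open>Equivalences of categories\<close>

lemma
  assumes "cat_equivalence S1 C1 S2 C2 Fo Fm"
  shows cat_equivalence_object: "\<pi> \<in> C1 \<Longrightarrow> Fo \<pi> \<in> C2"
    and cat_equivalence_id: "\<pi> \<in> C1 \<Longrightarrow> Fm \<pi> \<pi> (id_hom \<pi>) = id_hom (Fo \<pi>)"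
    and cat_equivalence_comp: "\<pi>1 \<in> C1 \<Longrightarrow> \<pi>2 \<in> C1 \<Longrightarrow> \<pi>3 \<in> C1 \<Longrightarrow> f \<in> Homs S1 \<pi>1 \<pi>2 \<Longrightarrow>
      g \<in> Homs S1 \<pi>2 \<pi>3 \<Longrightarrow> Fm \<pi>1 \<pi>3 (g \<circ> f) = Fm \<pi>2 \<pi>3 g \<circ> Fm \<pi>1 \<pi>2 f"
    and cat_equivalence_bij: "\<pi>1 \<in> C1 \<Longrightarrow> \<pi>2 \<in> C1 \<Longrightarrow>
      bij_betw (Fm \<pi>1 \<pi>2) (Homs S1 \<pi>1 \<pi>2) (Homs S2 (Fo \<pi>1) (Fo \<pi>2))"
    and cat_equivalence_surj: "\<rho> \<in> C2 \<Longrightarrow> \<exists>\<pi>\<in>C1. rep_iso S2 (Fo \<pi>) \<rho>"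
  using assms unfolding cat_equivalence_def id_hom_def by blast+

text \<open>Closure under subobjects in \<open>C1\<close> provides zero objects and kernels; in
  \<open>C2\<close> it makes a submodule an object, to which essential surjectivity applies.\<close>

locale rep_equivalence =
  fixes S1 :: "'g set" and C1 :: "('g, 'x) rep set" and S2 :: "'h set" and C2 :: "('h, 'y) rep set"
    and Fo Fm
  assumes equiv: "cat_equivalence S1 C1 S2 C2 Fo Fm"
    and stable1: "\<And>\<pi>. \<pi> \<in> C1 \<Longrightarrow> stable_rep S1 \<pi>"
    and stable2: "\<And>\<rho>. \<rho> \<in> C2 \<Longrightarrow> stable_rep S2 \<rho>"
    and sub1: "\<And>\<pi> U. \<pi> \<in> C1 \<Longrightarrow> invariant_subspace S1 \<pi> U \<Longrightarrow> (U, snd \<pi>) \<in> C1"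
    and sub2: "\<And>\<rho> U. \<rho> \<in> C2 \<Longrightarrow> invariant_subspace S2 \<rho> U \<Longrightarrow> (U, snd \<rho>) \<in> C2"
begin

lemmas object = cat_equivalence_object[OF equiv]
lemmas map_id = cat_equivalence_id[OF equiv]
lemmas map_comp = cat_equivalence_comp[OF equiv]
lemmas map_bij = cat_equivalence_bij[OF equiv]

lemma map_Homs: "\<pi>1 \<in> C1 \<Longrightarrow> \<pi>2 \<in> C1 \<Longrightarrow> f \<in> Homs S1 \<pi>1 \<pi>2 \<Longrightarrow> Fm \<pi>1 \<pi>2 f \<in> Homs S2 (Fo \<pi>1) (Fo \<pi>2)"
  using map_bij bij_betwE by blast

lemma map_inj: "\<pi>1 \<in> C1 \<Longrightarrow> \<pi>2 \<in> C1 \<Longrightarrow> f \<in> Homs S1 \<pi>1 \<pi>2 \<Longrightarrow> g \<in> Homs S1 \<pi>1 \<pi>2 \<Longrightarrow>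
    Fm \<pi>1 \<pi>2 f = Fm \<pi>1 \<pi>2 g \<Longrightarrow> f = g"
  using map_bij[THEN bij_betw_imp_inj_on] by (blast dest: inj_onD)

lemma map_full:
  assumes "\<pi>1 \<in> C1" "\<pi>2 \<in> C1" "h \<in> Homs S2 (Fo \<pi>1) (Fo \<pi>2)"
  obtains f where "f \<in> Homs S1 \<pi>1 \<pi>2" "Fm \<pi>1 \<pi>2 f = h"
  using map_bij[OF assms(1,2), THEN bij_betw_imp_surj_on] assms(3) by (metis imageE)

text \<open>To reflect isomorphisms, fullness lifts both morphisms and faithfulness lifts the two
  equations saying that they are mutually inverse.\<close>

lemma iso_iff:
  assumes C: "\<pi>1 \<in> C1" "\<pi>2 \<in> C1"
  shows "rep_iso S2 (Fo \<pi>1) (Fo \<pi>2) \<longleftrightarrow> rep_iso S1 \<pi>1 \<pi>2"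
proof
  assume "rep_iso S1 \<pi>1 \<pi>2"
  then obtain f g where fg: "f \<in> Homs S1 \<pi>1 \<pi>2" "g \<in> Homs S1 \<pi>2 \<pi>1"
    "g \<circ> f = id_hom \<pi>1" "f \<circ> g = id_hom \<pi>2"
    using rep_iso_iff[OF stable1 stable1] C by blast
  show "rep_iso S2 (Fo \<pi>1) (Fo \<pi>2)"
    unfolding rep_iso_iff[OF stable2 stable2, OF object object, OF C]
    using C fg map_comp map_id map_Homs by metis
next
  assume "rep_iso S2 (Fo \<pi>1) (Fo \<pi>2)"
  then obtain f g where fg: "f \<in> Homs S2 (Fo \<pi>1) (Fo \<pi>2)" "g \<in> Homs S2 (Fo \<pi>2) (Fo \<pi>1)"
    "g \<circ> f = id_hom (Fo \<pi>1)" "f \<circ> g = id_hom (Fo \<pi>2)"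
    using rep_iso_iff[OF stable2 stable2] object C by blast
  obtain f' g' where f': "f' \<in> Homs S1 \<pi>1 \<pi>2" "Fm \<pi>1 \<pi>2 f' = f"
    and g': "g' \<in> Homs S1 \<pi>2 \<pi>1" "Fm \<pi>2 \<pi>1 g' = g"
    using fg map_full C by metis
  have "g' \<circ> f' = id_hom \<pi>1"
    using C f' g' fg by (intro map_inj[OF C(1) C(1)]) (auto simp: map_comp map_id intro: Homs_comp id_hom_Homs stable1)
  moreover have "f' \<circ> g' = id_hom \<pi>2"
    using C f' g' fg by (intro map_inj[OF C(2) C(2)]) (auto simp: map_comp map_id intro: Homs_comp id_hom_Homs stable1)
  ultimately show "rep_iso S1 \<pi>1 \<pi>2"
    using rep_iso_iff[OF stable1 stable1, OF C] f' g' by blast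
qed

text \<open>On a non-zero space the identity and the zero map are different endomorphisms, so zero
  objects are those with exactly one. A functor that is bijective on morphisms preserves the number
  of endomorphisms.\<close>

lemma object_zero_iff:
  assumes "\<pi> \<in> C1" shows "fst (Fo \<pi>) = {0} \<longleftrightarrow> fst \<pi> = {0}"
proof -
  note st = stable1[OF assms] stable2[OF object[OF assms]]
  have one: "fst \<tau> = {0} \<longleftrightarrow> is_singleton (Homs S \<tau> \<tau>)" if "stable_rep S \<tau>" for S and \<tau> :: "('k, 'z) rep"
  proof
    assume zero: "fst \<tau> = {0}"
    have all0: "f = (\<lambda>v. 0)" if "f \<in> Homs S \<tau> \<tau>" for f
    proof
      fix v
      show "f v = 0"
        using Homs_0[OF that] Homs_outside[OF that, of v] zero by (cases "v = 0") auto
    qed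
    show "is_singleton (Homs S \<tau> \<tau>)"
    proof (rule is_singletonI')
      show "Homs S \<tau> \<tau> \<noteq> {}"
        using zero_Homs[OF that that] by blast
      fix f g assume "f \<in> Homs S \<tau> \<tau>" "g \<in> Homs S \<tau> \<tau>"
      then show "f = g"
        using all0[of f] all0[of g] by simp
    qed
  next
    assume "is_singleton (Homs S \<tau> \<tau>)"
    then have "id_hom \<tau> = (\<lambda>v. 0)"
      using zero_Homs[OF that that] id_hom_Homs[OF that] by (metis is_singletonE singletonD)
    then have "v = 0" if "v \<in> fst \<tau>" for v
      using that by (auto simp: id_hom_def dest: fun_cong[of _ _ v])
    then show "fst \<tau> = {0}"
      using stable_rep_zero[OF that] by blast
  qed
  show ?thesis
    unfolding one[OF st(1)] one[OF st(2)] is_singleton_altdef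
    using bij_betw_same_card[OF map_bij[OF assms assms]] by simp
qed

text \<open>The functor is not assumed to be additive; zero maps are recognized as those that factor
  through a zero object.\<close>

lemma map_zero:
  assumes C: "\<pi>1 \<in> C1" "\<pi>2 \<in> C1" shows "Fm \<pi>1 \<pi>2 (\<lambda>v. 0) = (\<lambda>v. 0)"
proof -
  \<comment> \<open>Taken as a subrepresentation of \<open>\<pi>1\<close>, this zero object lies in
    \<open>C1\<close> by closure under subobjects.\<close>
  let ?Z = "({0}, snd \<pi>1)"
  have "invariant_subspace S1 \<pi>1 {0}"
    using stable1[OF C(1)] stable_rep_zero[OF stable1[OF C(1)]]
    by (auto simp: invariant_subspace_def stable_rep_def cfun.subspace_def intro: lin_on_zero)
  then have Z: "?Z \<in> C1"
    using sub1 C by blast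
  let ?f = "(\<lambda>v. 0) :: _ \<Rightarrow> 'x \<Rightarrow> complex"
  have H: "?f \<in> Homs S1 \<pi>1 ?Z" "?f \<in> Homs S1 ?Z \<pi>2"
    using Z C by (auto intro!: zero_Homs stable1)
  have "Fm \<pi>1 \<pi>2 ?f = Fm ?Z \<pi>2 ?f \<circ> Fm \<pi>1 ?Z ?f"
    using map_comp[OF C(1) Z C(2) H] by (simp add: comp_def)
  also have "\<dots> = (\<lambda>v. 0)"
  proof
    fix v
    have FZ: "fst (Fo ?Z) = {0}"
      using object_zero_iff[OF Z] by simp
    have "Fm \<pi>1 ?Z ?f v = 0"
      using Homs_in[OF map_Homs[OF C(1) Z H(1)]] Homs_outside[OF map_Homs[OF C(1) Z H(1)]] FZ by auto
    then show "(Fm ?Z \<pi>2 ?f \<circ> Fm \<pi>1 ?Z ?f) v = 0"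
      using Homs_0[OF map_Homs[OF Z C(2) H(2)]] by simp
  qed
  finally show ?thesis .
qed

text \<open>A submodule of the image of an irreducible object comes from a monomorphism into that object,
  which is zero or an isomorphism; no quotients are needed.\<close>

lemma irreducible_object:
  assumes C: "\<pi> \<in> C1" and irr: "irreducible_rep S1 \<pi>"
  shows "irreducible_rep S2 (Fo \<pi>)"
  unfolding irreducible_rep_def
proof (intro conjI allI impI)
  show "fst (Fo \<pi>) \<noteq> {0}"
    using object_zero_iff[OF C] irr by (simp add: irreducible_rep_def)
  fix U assume U: "invariant_subspace S2 (Fo \<pi>) U"
  let ?U = "(U, snd (Fo \<pi>))"
  have UC: "?U \<in> C2"
    using sub2 object C U by blast
  obtain \<pi>1 where \<pi>1: "\<pi>1 \<in> C1" and "rep_iso S2 (Fo \<pi>1) ?U"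
    using cat_equivalence_surj[OF equiv UC] by blast
  then obtain i where i: "i \<in> Homs S2 (Fo \<pi>1) ?U" and ibij: "bij_betw i (fst (Fo \<pi>1)) U"
    by (auto simp: rep_iso_def)
  \<comment> \<open>Following \<open>i\<close> by the inclusion gives a morphism into
    \<open>Fo \<pi>\<close> itself with image \<open>U\<close>, which fullness can lift to
    \<open>C1\<close>.\<close>
  define f where "f = id_hom ?U \<circ> i"
  have f: "f \<in> Homs S2 (Fo \<pi>1) (Fo \<pi>)"
    unfolding f_def using i inclusion_Homs[OF stable2[OF object[OF C]] U] by (rule Homs_comp)
  have fi: "f v = i v" if "v \<in> fst (Fo \<pi>1)" for v
    using Homs_in[OF i that] by (simp add: f_def id_hom_def)
  have fbij: "bij_betw f (fst (Fo \<pi>1)) U"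
    using ibij fi by (simp cong: bij_betw_cong)
  obtain g where g: "g \<in> Homs S1 \<pi>1 \<pi>" and gf: "Fm \<pi>1 \<pi> g = f"
    using map_full[OF \<pi>1 C f] by blast
  have "g ` fst \<pi>1 = {0} \<or> g ` fst \<pi>1 = fst \<pi>"
    using irr image_invariant[OF stable1[OF \<pi>1] g] by (auto simp: irreducible_rep_def)
  then show "U = {0} \<or> U = fst (Fo \<pi>)"
  proof
    assume "g ` fst \<pi>1 = {0}"
    then have "g = (\<lambda>v. 0)"
      using Homs_outside[OF g] by (force simp: fun_eq_iff)
    then have "f = (\<lambda>v. 0)"
      using gf map_zero[OF \<pi>1 C] by simp
    then show ?thesis
      using fbij stable_rep_zero[OF stable2[OF UC]] by (auto simp: bij_betw_def)
  next
    assume im: "g ` fst \<pi>1 = fst \<pi>"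
    \<comment> \<open>Injectivity of \<open>g\<close> is pulled back from that of \<open>f\<close>:
      the inclusion of the kernel of \<open>g\<close> is sent to a map killed by the injective
      \<open>f\<close>, so its image under the functor is zero, and by faithfulness the inclusion is
      zero as well.\<close>
    let ?K = "({v \<in> fst \<pi>1. g v = 0}, snd \<pi>1)"
    have inv: "invariant_subspace S1 \<pi>1 {v \<in> fst \<pi>1. g v = 0}"
      using kernel_invariant[OF stable1 stable1 g] \<pi>1 C by blast
    have K: "?K \<in> C1"
      using sub1[OF \<pi>1 inv] .
    have j: "id_hom ?K \<in> Homs S1 ?K \<pi>1"
      using inclusion_Homs[OF stable1[OF \<pi>1] inv] .
    have "g \<circ> id_hom ?K = (\<lambda>v. 0)"
      using Homs_0[OF g] by (auto simp: id_hom_def fun_eq_iff)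
    then have fj: "f \<circ> Fm ?K \<pi>1 (id_hom ?K) = (\<lambda>v. 0)"
      using map_comp[OF K \<pi>1 C j g] map_zero[OF K C] gf by simp
    have "Fm ?K \<pi>1 (id_hom ?K) = (\<lambda>v. 0)"
    proof
      fix v
      let ?w = "Fm ?K \<pi>1 (id_hom ?K) v"
      have w: "?w \<in> fst (Fo \<pi>1)"
        using Homs_in[OF map_Homs[OF K \<pi>1 j], of v] Homs_outside[OF map_Homs[OF K \<pi>1 j], of v]
          stable_rep_zero[OF stable2[OF object[OF \<pi>1]]] by (cases "v \<in> fst (Fo ?K)") auto
      have "f ?w = f 0"
        using fun_cong[OF fj, of v] Homs_0[OF f] by simp
      then show "?w = 0"
        using fbij w stable_rep_zero[OF stable2[OF object[OF \<pi>1]]] by (auto simp: bij_betw_def dest: inj_onD)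
    qed
    then have "id_hom ?K = (\<lambda>v. 0)"
      using map_inj[OF K \<pi>1 j zero_Homs[OF stable1[OF K] stable1[OF \<pi>1]]] map_zero[OF K \<pi>1] by simp
    then have "v = 0" if "v \<in> fst \<pi>1" "g v = 0" for v
      using that by (auto simp: id_hom_def dest: fun_cong[of _ _ v])
    then have "bij_betw g (fst \<pi>1) (fst \<pi>)"
      using im injective_Homs[OF stable1[OF \<pi>1] g] by (auto simp: bij_betw_def)
    then obtain k where k: "k \<in> Homs S1 \<pi> \<pi>1" and gk: "g \<circ> k = id_hom \<pi>"
      using inverse_Homs[OF stable1[OF \<pi>1] g] by blast
    \<comment> \<open>The functor sends the right inverse of \<open>g\<close> to a right inverse of
      \<open>f\<close>, so \<open>f\<close> is onto and its image \<open>U\<close> is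
      everything.\<close>
    have fk: "f \<circ> Fm \<pi> \<pi>1 k = id_hom (Fo \<pi>)"
      using map_comp[OF C \<pi>1 C k g] map_id[OF C] gf gk by simp
    have "f (Fm \<pi> \<pi>1 k w) = w" if "w \<in> fst (Fo \<pi>)" for w
      using that fun_cong[OF fk, of w] by (simp add: id_hom_def)
    then have "fst (Fo \<pi>) \<subseteq> f ` fst (Fo \<pi>1)"
      using Homs_in[OF map_Homs[OF C \<pi>1 k]] by (metis imageI subsetI)
    then show ?thesis
      using fbij U by (auto simp: bij_betw_def invariant_subspace_def)
  qed
qed

end


section \<open>Conjugation of matrix groups\<close>

text \<open>Besides group elements this set is used for Gram matrices: \<open>B \<in> gl N\<close>
  expresses that the form is nondegenerate.\<close>

definition gl :: "nat \<Rightarrow> 'f::field mat set"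
  where "gl N = {g \<in> carrier_mat N N. Determinant.det g \<noteq> 0}"

definition cj :: "'f::field mat \<Rightarrow> 'f mat \<Rightarrow> 'f mat"
  where "cj g l = g * l * mat_inv g"

lemma gl_carrier: "g \<in> gl N \<Longrightarrow> g \<in> carrier_mat N N"
  by (simp add: gl_def)

lemma mat_inv_eqI:
  assumes "g \<in> carrier_mat N N" "h \<in> carrier_mat N N" "g * h = 1\<^sub>m N" "h * g = 1\<^sub>m N"
  shows "mat_inv g = h"
proof -
  have uniq: "k = h" if "k \<in> carrier_mat N N" "k * g = 1\<^sub>m N" for k
  proof -
    have "k = k * (g * h)"
      using that assms by simp
    also have "\<dots> = (k * g) * h"
      using that assms by (intro assoc_mult_mat[symmetric])
    finally show ?thesis
      using that assms by simp
  qed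
  have dim: "dim_row g = N"
    using assms(1) by simp
  show ?thesis
    unfolding mat_inv_def dim by (rule the_equality) (use assms uniq in blast)+
qed

lemma mat_inv:
  assumes "g \<in> gl N"
  shows "mat_inv g \<in> gl N" "g * mat_inv g = 1\<^sub>m N" "mat_inv g * g = 1\<^sub>m N"
proof -
  have g: "g \<in> carrier_mat N N" "Determinant.det g \<noteq> 0"
    using assms by (auto simp: gl_def)
  obtain h where h: "h \<in> carrier_mat N N" "h * g = 1\<^sub>m N" "g * h = 1\<^sub>m N"
    \<comment> \<open>The argument \<open>undefined\<close> fills the record extension slot of the
      matrix ring, on which its units do not depend.\<close>
    using det_non_zero_imp_unit[OF g, of undefined] by (auto simp: Units_def ring_mat_def)
  have eq: "mat_inv g = h"
    using mat_inv_eqI[OF g(1) h(1)] h by simp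
  have "Determinant.det h * Determinant.det g = 1"
    using det_mult[OF h(1) g(1)] h(2) by simp
  then show "mat_inv g \<in> gl N" "g * mat_inv g = 1\<^sub>m N" "mat_inv g * g = 1\<^sub>m N"
    using h eq by (auto simp: gl_def)
qed

lemma mat_inv_mat_inv: "g \<in> gl N \<Longrightarrow> mat_inv (mat_inv g) = g"
  using mat_inv[of g N] by (intro mat_inv_eqI[where N = N]) (auto simp: gl_def)

text \<open>The form in which adjacent inverses cancel once products have been associated to the
  right.\<close>

lemma mat_cancel_left:
  fixes g :: "'f::field mat"
  assumes "g * h = 1\<^sub>m N" "g \<in> carrier_mat N N" "h \<in> carrier_mat N N" "x \<in> carrier_mat N N"
  shows "g * (h * x) = x"
proof -
  have "g * (h * x) = (g * h) * x"
    using assms by (intro assoc_mult_mat[symmetric])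
  then show ?thesis
    using assms by simp
qed

lemma mat_inv_mult:
  assumes "g \<in> gl N" "h \<in> gl N" shows "mat_inv (g * h) = mat_inv h * mat_inv g"
proof -
  note c = gl_carrier[OF assms(1)] gl_carrier[OF assms(2)]
    gl_carrier[OF mat_inv(1)[OF assms(1)]] gl_carrier[OF mat_inv(1)[OF assms(2)]]
  note a = assoc_mult_mat[where n\<^sub>1 = N and n\<^sub>2 = N and n\<^sub>3 = N and n\<^sub>4 = N]
  show ?thesis
    using c assms by (intro mat_inv_eqI[where N = N])
      (simp_all add: a mat_cancel_left[OF mat_inv(2), where N = N]
        mat_cancel_left[OF mat_inv(3), where N = N] mat_inv[where N = N])
qed

lemma cj_carrier: "g \<in> gl N \<Longrightarrow> l \<in> carrier_mat N N \<Longrightarrow> cj g l \<in> carrier_mat N N"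
  using mat_inv(1)[of g N] by (auto simp: cj_def gl_def)

lemma cj_cj:
  assumes "g \<in> gl N" "h \<in> gl N" "l \<in> carrier_mat N N"
  shows "cj g (cj h l) = cj (g * h) l"
proof -
  note c = gl_carrier[OF assms(1)] gl_carrier[OF assms(2)]
    gl_carrier[OF mat_inv(1)[OF assms(1)]] gl_carrier[OF mat_inv(1)[OF assms(2)]]
  note a = assoc_mult_mat[where n\<^sub>1 = N and n\<^sub>2 = N and n\<^sub>3 = N and n\<^sub>4 = N]
  show ?thesis
    using c assms by (simp add: cj_def a mat_inv_mult)
qed

lemma mat_inv_one: "mat_inv (1\<^sub>m N) = 1\<^sub>m N"
  by (rule mat_inv_eqI[where N = N]) auto

lemma cj_one_left: "l \<in> carrier_mat N N \<Longrightarrow> cj (1\<^sub>m N) l = l"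
  by (simp add: cj_def mat_inv_one)

lemma cj_inv_cancel: "g \<in> gl N \<Longrightarrow> l \<in> carrier_mat N N \<Longrightarrow> cj (mat_inv g) (cj g l) = l"
  using mat_inv[of g N] by (simp add: cj_cj[where N = N] cj_one_left)

lemma cj_cancel: "g \<in> gl N \<Longrightarrow> l \<in> carrier_mat N N \<Longrightarrow> cj g (cj (mat_inv g) l) = l"
  using mat_inv[of g N] by (simp add: cj_cj[where N = N] cj_one_left)

lemma cj_mult:
  assumes "g \<in> gl N" "l \<in> carrier_mat N N" "m \<in> carrier_mat N N"
  shows "cj g (l * m) = cj g l * cj g m"
proof -
  note c = gl_carrier[OF assms(1)] gl_carrier[OF mat_inv(1)[OF assms(1)]]
  note a = assoc_mult_mat[where n\<^sub>1 = N and n\<^sub>2 = N and n\<^sub>3 = N and n\<^sub>4 = N]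
  show ?thesis
    using c assms by (simp add: cj_def a mat_cancel_left[OF mat_inv(3), where N = N])
qed

lemma cj_one: "g \<in> gl N \<Longrightarrow> cj g (1\<^sub>m N) = 1\<^sub>m N"
  using gl_carrier[of g N] mat_inv(2)[of g N] by (simp add: cj_def)

lemma conj_set_cj: "conj_set g L = cj g ` L"
  by (auto simp: conj_set_def cj_def)

lemma conj_set_conj_set:
  assumes "g \<in> gl N" "h \<in> gl N" "L \<subseteq> carrier_mat N N"
  shows "conj_set g (conj_set h L) = conj_set (g * h) L"
  using assms by (auto simp: conj_set_cj image_image subset_iff cj_cj[where N = N] intro!: image_cong)

lemma conj_rep_cj: "g \<in> gl N \<Longrightarrow> conj_rep g \<sigma> = (fst \<sigma>, \<lambda>l. snd \<sigma> (cj (mat_inv g) l))"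
  by (simp add: conj_rep_def cj_def mat_inv_mat_inv)

section \<open>Isometry groups are closed under products and inverses\<close>

lemma isom_group_gl:
  assumes "B \<in> gl N" "g \<in> isom_group N B" shows "g \<in> gl N"
proof -
  have B: "B \<in> carrier_mat N N" "Determinant.det B \<noteq> 0" and g: "g \<in> carrier_mat N N"
    and eq: "transpose_mat g * B * g = B"
    using assms by (auto simp: gl_def isom_group_def)
  \<comment> \<open>Determinants are compared in the isometry equation: that of \<open>B\<close> is
    non-zero, hence so is that of \<open>g\<close>.\<close>
  have "Determinant.det (transpose_mat g * B * g) = Determinant.det (transpose_mat g * B) * Determinant.det g"
    using B g by (intro det_mult[where n = N]) auto
  then show ?thesis
    using eq B g by (auto simp: gl_def)
qed

lemma isom_group_mult:
  assumes B: "B \<in> carrier_mat N N" and "g \<in> isom_group N B" "h \<in> isom_group N B"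
  shows "g * h \<in> isom_group N B"
proof -
  have g: "g \<in> carrier_mat N N" "transpose_mat g * B * g = B"
    and h: "h \<in> carrier_mat N N" "transpose_mat h * B * h = B"
    using assms by (auto simp: isom_group_def)
  note a = assoc_mult_mat[where n\<^sub>1 = N and n\<^sub>2 = N and n\<^sub>3 = N and n\<^sub>4 = N]
  have "transpose_mat (g * h) * B * (g * h) = transpose_mat h * (transpose_mat g * B * g) * h"
    using g(1) h(1) B by (simp add: a transpose_mult[where nr = N and n = N and nc = N])
  then show ?thesis
    using g h by (auto simp: isom_group_def)
qed

lemma isom_group_inv:
  assumes "B \<in> gl N" "g \<in> isom_group N B" shows "mat_inv g \<in> isom_group N B"
proof -
  have gg: "g \<in> gl N"
    using isom_group_gl[OF assms] .
  let ?h = "mat_inv g"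
  have c: "g \<in> carrier_mat N N" "?h \<in> carrier_mat N N" "B \<in> carrier_mat N N"
    using gg mat_inv(1)[OF gg] assms by (auto simp: gl_def)
  have eq: "transpose_mat g * B * g = B"
    using assms by (auto simp: isom_group_def)
  have t: "transpose_mat ?h * transpose_mat g = 1\<^sub>m N"
    using transpose_mult[OF c(1,2)] mat_inv(2)[OF gg] by simp
  note a = assoc_mult_mat[where n\<^sub>1 = N and n\<^sub>2 = N and n\<^sub>3 = N and n\<^sub>4 = N]
  have "transpose_mat ?h * B * ?h = transpose_mat ?h * (transpose_mat g * B * g) * ?h"
    using eq by simp
  also have "\<dots> = transpose_mat ?h * (transpose_mat g * (B * (g * ?h)))"
    using c by (simp add: a)
  also have "\<dots> = B"
    using c mat_inv(2)[OF gg] mat_cancel_left[OF t] by simp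
  finally show ?thesis
    using c by (simp add: isom_group_def)
qed


section \<open>Unramified characters\<close>

lemma
  assumes "local_field av"
  shows local_field_nonneg: "av x \<ge> 0"
    and local_field_zero: "av x = 0 \<longleftrightarrow> x = 0"
    and local_field_mult: "av (x * y) = av x * av y"
    and local_field_add: "av (x + y) \<le> max (av x) (av y)"
  using assms by (auto simp: local_field_def)

text \<open>By the ultrametric inequality a sum obeys the bound of its terms, however many there
  are; \<open>e \<ge> 0\<close> covers the empty sum. For this reason entries of matrix products are
  bounded by the product of the bounds, without a factor \<open>N\<close>.\<close>

lemma local_field_sum_le:
  assumes "local_field av" "finite I" "e \<ge> 0" "\<And>i. i \<in> I \<Longrightarrow> av (f i) \<le> e"
  shows "av (sum f I) \<le> e"
  using assms(2,4)
proof (induction I rule: finite_induct)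
  case empty
  then show ?case
    using local_field_zero[OF assms(1), of 0] assms(3) by simp
next
  case (insert i I)
  have "av (f i + sum f I) \<le> max (av (f i)) (av (sum f I))"
    using local_field_add[OF assms(1)] .
  also have "\<dots> \<le> e"
    using insert by simp
  finally show ?case
    using insert by simp
qed

lemma mat_le_mult:
  assumes av: "local_field av" and A: "A \<in> carrier_mat N N" "mat_le av a A"
    and B: "B \<in> carrier_mat N N" "mat_le av b B" and "a \<ge> 0" "b \<ge> 0"
  shows "mat_le av (a * b) (A * B)"
  unfolding mat_le_def
proof (intro allI impI)
  fix i j assume ij: "i < dim_row (A * B)" "j < dim_col (A * B)"
  have "av (A $$ (i, k) * B $$ (k, j)) \<le> a * b" if "k < N" for k
    using that ij A B assms(6,7) local_field_nonneg[OF av]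
    by (auto simp: local_field_mult[OF av] mat_le_def intro!: mult_mono)
  then have "av (\<Sum>k<N. A $$ (i, k) * B $$ (k, j)) \<le> a * b"
    using assms(6,7) by (intro local_field_sum_le[OF av]) auto
  then show "av ((A * B) $$ (i, j)) \<le> a * b"
    using ij A B by (simp add: scalar_prod_def atLeast0LessThan)
qed

lemma mat_le_exists:
  assumes av: "local_field av" and A: "A \<in> carrier_mat N N"
  shows "\<exists>a>0. mat_le av a A"
proof (intro exI conjI)
  \<comment> \<open>The summand 1 keeps the bound positive even for the zero matrix and for
    \<open>N = 0\<close>.\<close>
  let ?a = "1 + (\<Sum>(i, j)\<in>{..<N} \<times> {..<N}. av (A $$ (i, j)))"
  show "?a > 0"
    using local_field_nonneg[OF av] by (auto intro!: add_pos_nonneg sum_nonneg)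
  show "mat_le av ?a A"
    unfolding mat_le_def
  proof (intro allI impI)
    fix i j assume "i < dim_row A" "j < dim_col A"
    then have "(case (i, j) of (i, j) \<Rightarrow> av (A $$ (i, j))) \<le> (\<Sum>(i, j)\<in>{..<N} \<times> {..<N}. av (A $$ (i, j)))"
      using A local_field_nonneg[OF av] by (intro member_le_sum) auto
    then show "av (A $$ (i, j)) \<le> ?a" by simp
  qed
qed

lemma cj_minus:
  assumes "g \<in> gl N" "A \<in> carrier_mat N N" "B \<in> carrier_mat N N"
  shows "cj g A - cj g B = g * (A - B) * mat_inv g"
  using assms gl_carrier[OF assms(1)] gl_carrier[OF mat_inv(1)[OF assms(1)]]
  by (simp add: cj_def minus_mult_distrib_mat[where nr = N and nc = N and n = N]
      mult_minus_distrib_mat[where nr = N and nc = N and n = N])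

text \<open>Conjugation by \<open>g\<close> is Lipschitz with constant \<open>a * b\<close>, where
  \<open>a\<close> and \<open>b\<close> bound the entries of \<open>g\<close> and of its inverse, so
  it carries convergent subsequences to convergent ones.\<close>

lemma mat_compact_conj_set:
  assumes av: "local_field av" and g: "g \<in> gl N" and K: "K \<subseteq> carrier_mat N N" "mat_compact av K"
  shows "mat_compact av (conj_set g K)"
  unfolding mat_compact_def
proof (intro allI impI)
  fix X :: "nat \<Rightarrow> _" assume X: "\<forall>i. X i \<in> conj_set g K"
  then have "\<forall>i. \<exists>y\<in>K. X i = cj g y"
    by (auto simp: conj_set_cj image_iff)
  then obtain Y where Y: "\<And>i. Y i \<in> K" and XY: "\<And>i. X i = cj g (Y i)"
    by metis
  have "\<exists>(r::nat \<Rightarrow> nat) A. strict_mono r \<and> A \<in> K \<and> (\<forall>e>0. \<exists>M. \<forall>i\<ge>M. mat_le av e (Y (r i) - A))"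
    by (rule K(2)[unfolded mat_compact_def, rule_format]) (rule Y)
  then obtain r :: "nat \<Rightarrow> nat" and A where r: "strict_mono r" and A: "A \<in> K"
    and lim: "\<forall>e>0. \<exists>M. \<forall>i\<ge>M. mat_le av e (Y (r i) - A)"
    by blast
  have gc: "g \<in> carrier_mat N N" "mat_inv g \<in> carrier_mat N N"
    using g mat_inv(1)[OF g] by (auto simp: gl_def)
  obtain a b where a: "a > 0" "mat_le av a g" and b: "b > 0" "mat_le av b (mat_inv g)"
    using mat_le_exists[OF av gc(1)] mat_le_exists[OF av gc(2)] by blast
  have "\<exists>M. \<forall>i\<ge>M. mat_le av e (X (r i) - cj g A)" if e: "e > 0" for e
  proof -
    define d where "d = e / (a * b)"
    have d: "d > 0" "a * d * b = e"
      using e a b by (auto simp: d_def)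
    then obtain M where M: "\<And>i. i \<ge> M \<Longrightarrow> mat_le av d (Y (r i) - A)"
      using lim by blast
    have "mat_le av e (X (r i) - cj g A)" if "i \<ge> M" for i
    proof -
      have c: "Y (r i) \<in> carrier_mat N N" "A \<in> carrier_mat N N"
        using K Y A by auto
      have "mat_le av (a * d * b) (g * (Y (r i) - A) * mat_inv g)"
        using c gc a b d M[OF that] by (intro mat_le_mult[OF av, where N = N]) auto
      then show ?thesis
        using d cj_minus[OF g c] XY by simp
    qed
    then show ?thesis by blast
  qed
  then show "\<exists>(r::nat \<Rightarrow> nat) A. strict_mono r \<and> A \<in> conj_set g K \<and> (\<forall>e>0. \<exists>M. \<forall>i\<ge>M. mat_le av e (X (r i) - A))"
    using r A by (intro exI[of _ r] exI[of _ "cj g A"] conjI) (simp_all add: conj_set_cj)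
qed

lemma mat_subgroup_conj_set:
  assumes g: "g \<in> gl N" and K: "mat_subgroup N K" shows "mat_subgroup N (conj_set g K)"
proof -
  have K': "K \<subseteq> carrier_mat N N" "1\<^sub>m N \<in> K"
    using K by (auto simp: mat_subgroup_def)
  have "\<exists>h\<in>conj_set g K. cj g k * h = 1\<^sub>m N \<and> h * cj g k = 1\<^sub>m N" if k: "k \<in> K" for k
  proof -
    obtain h where h: "h \<in> K" "k * h = 1\<^sub>m N" "h * k = 1\<^sub>m N"
      using K k by (auto simp: mat_subgroup_def)
    have c: "k \<in> carrier_mat N N" "h \<in> carrier_mat N N"
      using h k K' by auto
    have "cj g k * cj g h = 1\<^sub>m N" "cj g h * cj g k = 1\<^sub>m N"
      using cj_mult[OF g c] cj_mult[OF g c(2) c(1)] h cj_one[OF g] by simp_all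
    then show ?thesis
      using h by (auto simp: conj_set_cj)
  qed
  moreover have "cj g h * cj g k \<in> conj_set g K" if "h \<in> K" "k \<in> K" for h k
  proof -
    have "h * k \<in> K"
      using that K by (auto simp: mat_subgroup_def)
    moreover have "cj g h * cj g k = cj g (h * k)"
      using that K' by (intro cj_mult[OF g, symmetric]) auto
    ultimately show ?thesis
      by (simp add: conj_set_cj)
  qed
  moreover have "1\<^sub>m N \<in> conj_set g K"
    using K' cj_one[OF g] by (force simp: conj_set_cj)
  ultimately show ?thesis
    using K' cj_carrier[OF g] by (auto simp: mat_subgroup_def conj_set_cj)
qed

lemma unramified_mult: "unramified av N L \<kappa> \<Longrightarrow> unramified av N L \<kappa>' \<Longrightarrow> unramified av N L (\<lambda>g. \<kappa> g * \<kappa>' g)"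
  by (auto simp: unramified_def)

lemma unramified_inverse: "unramified av N L \<kappa> \<Longrightarrow> unramified av N L (\<lambda>g. inverse (\<kappa> g))"
  by (auto simp: unramified_def)

text \<open>Triviality on a compact subgroup of \<open>L\<close> follows from triviality on its
  conjugate, which is again a compact subgroup. This allows twists on conjugate Levi subgroups to be
  combined.\<close>

lemma unramified_conj:
  assumes av: "local_field av" and g: "g \<in> gl N" and L: "L \<subseteq> carrier_mat N N"
    and \<kappa>: "unramified av N (conj_set g L) \<kappa>"
  shows "unramified av N L (\<lambda>l. \<kappa> (cj g l))"
  unfolding unramified_def
proof (intro conjI ballI allI impI)
  fix l assume "l \<in> L"
  then show "\<kappa> (cj g l) \<noteq> 0"
    using \<kappa> by (auto simp: unramified_def conj_set_cj)
next
  fix l m assume lm: "l \<in> L" "m \<in> L"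
  then have "\<kappa> (cj g l * cj g m) = \<kappa> (cj g l) * \<kappa> (cj g m)"
    using \<kappa> by (auto simp: unramified_def conj_set_cj)
  then show "\<kappa> (cj g (l * m)) = \<kappa> (cj g l) * \<kappa> (cj g m)"
    using cj_mult[OF g] lm L by (simp add: subset_iff)
next
  fix K k assume K: "mat_subgroup N K \<and> K \<subseteq> L \<and> mat_compact av K" and k: "k \<in> K"
  then have "mat_subgroup N (conj_set g K)" "mat_compact av (conj_set g K)" "conj_set g K \<subseteq> conj_set g L"
    using mat_subgroup_conj_set[OF g] mat_compact_conj_set[OF av g] L by (auto simp: conj_set_cj)
  then show "\<kappa> (cj g k) = 1"
    using \<kappa> k by (auto simp: unramified_def conj_set_cj)
qed


section \<open>Inertial equivalence\<close>

lemma cuspidal_pairs_carrier: "(L, \<sigma>) \<in> cuspidal_pairs av N B \<Longrightarrow> L \<subseteq> carrier_mat N N"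
  by (auto simp: cuspidal_pairs_def levi_subgroups_def levi_def isom_group_def)

lemma cuspidal_pairs_stable: "(L, \<sigma>) \<in> cuspidal_pairs av N B \<Longrightarrow> stable_rep L \<sigma>"
  by (auto simp: cuspidal_pairs_def supercuspidal_def Irr_smooth_def intro: smooth_rep_stable)

text \<open>Here the intertwining map is freed from the convention of vanishing outside its source,
  and conjugation is written with \<open>cj\<close>. Composites and inverses of such maps can then
  be formed without case distinctions.\<close>

lemma inertial_class_iff:
  assumes B: "B \<in> gl N"
  shows "(L', \<sigma>') \<in> inertial_class av N B (L, \<sigma>) \<longleftrightarrow> (L', \<sigma>') \<in> cuspidal_pairs av N B \<and>
    (\<exists>g\<in>isom_group N B. \<exists>\<kappa>. unramified av N L \<kappa> \<and> L' = conj_set g L \<and>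
      (\<exists>f. lin_on (fst \<sigma>') (fst \<sigma>) f \<and> bij_betw f (fst \<sigma>') (fst \<sigma>) \<and>
        (\<forall>l\<in>L'. \<forall>v\<in>fst \<sigma>'. f (snd \<sigma>' l v) =
           smul (\<kappa> (cj (mat_inv g) l)) (snd \<sigma> (cj (mat_inv g) l) (f v)))))"
proof -
  have iso: "rep_iso L' \<sigma>' (conj_rep g (twist \<kappa> \<sigma>)) \<longleftrightarrow>
     (\<exists>f. lin_on (fst \<sigma>') (fst \<sigma>) f \<and> bij_betw f (fst \<sigma>') (fst \<sigma>) \<and>
        (\<forall>l\<in>L'. \<forall>v\<in>fst \<sigma>'. f (snd \<sigma>' l v) =
           smul (\<kappa> (cj (mat_inv g) l)) (snd \<sigma> (cj (mat_inv g) l) (f v))))" (is "_ \<longleftrightarrow> ?R")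
    if g: "g \<in> isom_group N B" and c: "(L', \<sigma>') \<in> cuspidal_pairs av N B" for g \<kappa>
  proof
    assume "rep_iso L' \<sigma>' (conj_rep g (twist \<kappa> \<sigma>))"
    then show ?R
      unfolding rep_iso_def Homs_def conj_rep_cj[OF isom_group_gl[OF B g]] by (auto simp: twist_def)
  next
    assume ?R
    then obtain f where f: "lin_on (fst \<sigma>') (fst \<sigma>) f" "bij_betw f (fst \<sigma>') (fst \<sigma>)"
      "\<And>l v. l \<in> L' \<Longrightarrow> v \<in> fst \<sigma>' \<Longrightarrow> f (snd \<sigma>' l v) =
         smul (\<kappa> (cj (mat_inv g) l)) (snd \<sigma> (cj (mat_inv g) l) (f v))"
      by blast
    note st = cuspidal_pairs_stable[OF c]
    \<comment> \<open>Cutting \<open>f\<close> off by zero makes it an element of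
      \<open>Homs\<close> again.\<close>
    let ?f = "\<lambda>v. if v \<in> fst \<sigma>' then f v else 0"
    have "?f \<in> Homs L' \<sigma>' (conj_rep g (twist \<kappa> \<sigma>))"
      unfolding Homs_def conj_rep_cj[OF isom_group_gl[OF B g]]
      using st f(1,3) stable_rep_act[OF st]
      by (auto simp: twist_def lin_on_def stable_rep_def intro: cfun.subspace_add cfun.subspace_scale)
    moreover have "bij_betw ?f (fst \<sigma>') (fst (conj_rep g (twist \<kappa> \<sigma>)))"
      using f(2) bij_betw_cong[of "fst \<sigma>'" ?f f "fst \<sigma>"] by (simp add: conj_rep_def twist_def)
    ultimately show "rep_iso L' \<sigma>' (conj_rep g (twist \<kappa> \<sigma>))"
      by (auto simp: rep_iso_def)
  qed
  have "(L', \<sigma>') \<in> inertial_class av N B (L, \<sigma>) \<longleftrightarrow> (L', \<sigma>') \<in> cuspidal_pairs av N B \<and>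
    (\<exists>g\<in>isom_group N B. \<exists>\<kappa>. unramified av N L \<kappa> \<and> L' = conj_set g L \<and>
      rep_iso L' \<sigma>' (conj_rep g (twist \<kappa> \<sigma>)))"
    by (simp add: inertial_class_def)
  also have "\<dots> \<longleftrightarrow> (L', \<sigma>') \<in> cuspidal_pairs av N B \<and>
    (\<exists>g\<in>isom_group N B. \<exists>\<kappa>. unramified av N L \<kappa> \<and> L' = conj_set g L \<and>
      (\<exists>f. lin_on (fst \<sigma>') (fst \<sigma>) f \<and> bij_betw f (fst \<sigma>') (fst \<sigma>) \<and>
        (\<forall>l\<in>L'. \<forall>v\<in>fst \<sigma>'. f (snd \<sigma>' l v) =
           smul (\<kappa> (cj (mat_inv g) l)) (snd \<sigma> (cj (mat_inv g) l) (f v)))))"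
    by (intro conj_cong[OF refl] bex_cong[OF refl] ex_cong1 iso)
  finally show ?thesis .
qed

lemma smul_smul: "smul a (smul b v) = smul (a * b) v"
  by (auto simp: smul_def)

lemma smul_one: "smul 1 v = v"
  by (auto simp: smul_def)

lemma inertial_class_trans:
  assumes av: "local_field av" and B: "B \<in> gl N" and x: "x \<in> cuspidal_pairs av N B"
    and xy: "y \<in> inertial_class av N B x" and yz: "z \<in> inertial_class av N B y"
  shows "z \<in> inertial_class av N B x"
proof -
  obtain L \<sigma> L' \<sigma>' L'' \<sigma>'' where eqs: "x = (L, \<sigma>)" "y = (L', \<sigma>')" "z = (L'', \<sigma>'')"
    by (cases x, cases y, cases z)
  obtain g \<kappa> f where y: "(L', \<sigma>') \<in> cuspidal_pairs av N B" and g: "g \<in> isom_group N B"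
    and \<kappa>: "unramified av N L \<kappa>" and L': "L' = conj_set g L"
    and f: "lin_on (fst \<sigma>') (fst \<sigma>) f" "bij_betw f (fst \<sigma>') (fst \<sigma>)"
      "\<And>l v. l \<in> L' \<Longrightarrow> v \<in> fst \<sigma>' \<Longrightarrow> f (snd \<sigma>' l v) =
         smul (\<kappa> (cj (mat_inv g) l)) (snd \<sigma> (cj (mat_inv g) l) (f v))"
    using xy unfolding eqs inertial_class_iff[OF B] by blast
  obtain g' \<kappa>' f' where z: "(L'', \<sigma>'') \<in> cuspidal_pairs av N B" and g': "g' \<in> isom_group N B"
    and \<kappa>': "unramified av N L' \<kappa>'" and L'': "L'' = conj_set g' L'"
    and f': "lin_on (fst \<sigma>'') (fst \<sigma>') f'" "bij_betw f' (fst \<sigma>'') (fst \<sigma>')"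
      "\<And>l v. l \<in> L'' \<Longrightarrow> v \<in> fst \<sigma>'' \<Longrightarrow> f' (snd \<sigma>'' l v) =
         smul (\<kappa>' (cj (mat_inv g') l)) (snd \<sigma>' (cj (mat_inv g') l) (f' v))"
    using yz unfolding eqs inertial_class_iff[OF B] by blast
  have gl: "g \<in> gl N" "g' \<in> gl N"
    using isom_group_gl[OF B] g g' by auto
  have Lc: "L \<subseteq> carrier_mat N N" "L' \<subseteq> carrier_mat N N" "L'' \<subseteq> carrier_mat N N"
    using x y z cuspidal_pairs_carrier unfolding eqs by blast+
  \<comment> \<open>Since \<open>\<kappa>'\<close> is a character of \<open>L'\<close>, the
    conjugate of \<open>L\<close> by \<open>g\<close>, it has to be pulled back to \<open>L\<close>
    before the twists are multiplied.\<close>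
  let ?\<kappa> = "\<lambda>l. \<kappa> l * \<kappa>' (cj g l)"
  have "unramified av N L ?\<kappa>"
    using unramified_mult[OF \<kappa> unramified_conj[OF av gl(1) Lc(1) \<kappa>'[unfolded L']]] .
  moreover have "L'' = conj_set (g' * g) L"
    using conj_set_conj_set[OF gl(2,1) Lc(1)] L' L'' by simp
  moreover have "g' * g \<in> isom_group N B"
    using isom_group_mult[OF gl_carrier[OF B] g' g] .
  moreover have "lin_on (fst \<sigma>'') (fst \<sigma>) (\<lambda>v. f (f' v))"
    using f'(1) f(1) by (rule lin_on_compose)
  moreover have "bij_betw (\<lambda>v. f (f' v)) (fst \<sigma>'') (fst \<sigma>)"
    using bij_betw_trans[OF f'(2) f(2)] by (simp add: comp_def)
  moreover have "f (f' (snd \<sigma>'' l v)) = smul (?\<kappa> (cj (mat_inv (g' * g)) l))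
      (snd \<sigma> (cj (mat_inv (g' * g)) l) (f (f' v)))" if l: "l \<in> L''" and v: "v \<in> fst \<sigma>''" for l v
  proof -
    let ?l = "cj (mat_inv g') l"
    have lc: "l \<in> carrier_mat N N"
      using l Lc by blast
    obtain m where m: "m \<in> L'" "l = cj g' m"
      using l L'' by (auto simp: conj_set_cj)
    then have lm: "?l = m"
      using cj_inv_cancel[OF gl(2)] Lc by auto
    have e: "cj (mat_inv (g' * g)) l = cj (mat_inv g) ?l"
      using cj_cj[OF mat_inv(1)[OF gl(1)] mat_inv(1)[OF gl(2)] lc] mat_inv_mult[OF gl(2,1)] by simp
    have e': "cj g (cj (mat_inv g) ?l) = ?l"
      using cj_cancel[OF gl(1)] m Lc lm by auto
    have v': "f' v \<in> fst \<sigma>'"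
      using f'(1) v by (auto simp: lin_on_def)
    have "f (f' (snd \<sigma>'' l v)) = f (smul (\<kappa>' ?l) (snd \<sigma>' ?l (f' v)))"
      using f'(3)[OF l v] by simp
    also have "\<dots> = smul (\<kappa>' ?l) (f (snd \<sigma>' ?l (f' v)))"
      using f(1) stable_rep_act[OF cuspidal_pairs_stable[OF y] _ v'] m lm by (auto simp: lin_on_def)
    also have "\<dots> = smul (\<kappa>' ?l) (smul (\<kappa> (cj (mat_inv g) ?l)) (snd \<sigma> (cj (mat_inv g) ?l) (f (f' v))))"
      using f(3)[of ?l, OF _ v'] m lm by simp
    also have "\<dots> = smul (?\<kappa> (cj (mat_inv (g' * g)) l)) (snd \<sigma> (cj (mat_inv (g' * g)) l) (f (f' v)))"
      unfolding e e' smul_smul by (simp add: mult.commute)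
    finally show ?thesis .
  qed
  ultimately show ?thesis
    unfolding eqs inertial_class_iff[OF B]
    by (intro conjI z bexI[of _ "g' * g"] exI[of _ ?\<kappa>] exI[of _ "\<lambda>v. f (f' v)"]) auto
qed

lemma inertial_class_sym:
  assumes av: "local_field av" and B: "B \<in> gl N" and x: "x \<in> cuspidal_pairs av N B"
    and xy: "y \<in> inertial_class av N B x"
  shows "x \<in> inertial_class av N B y"
proof -
  obtain L \<sigma> L' \<sigma>' where eqs: "x = (L, \<sigma>)" "y = (L', \<sigma>')"
    by (cases x, cases y)
  obtain g \<kappa> f where y: "(L', \<sigma>') \<in> cuspidal_pairs av N B" and g: "g \<in> isom_group N B"
    and \<kappa>: "unramified av N L \<kappa>" and L': "L' = conj_set g L"
    and f: "lin_on (fst \<sigma>') (fst \<sigma>) f" "bij_betw f (fst \<sigma>') (fst \<sigma>)"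
      "\<And>l v. l \<in> L' \<Longrightarrow> v \<in> fst \<sigma>' \<Longrightarrow> f (snd \<sigma>' l v) =
         smul (\<kappa> (cj (mat_inv g) l)) (snd \<sigma> (cj (mat_inv g) l) (f v))"
    using xy unfolding eqs inertial_class_iff[OF B] by blast
  have gl: "g \<in> gl N" "mat_inv g \<in> gl N"
    using isom_group_gl[OF B g] mat_inv(1) by auto
  have Lc: "L \<subseteq> carrier_mat N N" "L' \<subseteq> carrier_mat N N"
    using x y cuspidal_pairs_carrier unfolding eqs by blast+
  note st = cuspidal_pairs_stable[OF x[unfolded eqs]] cuspidal_pairs_stable[OF y]
  have L: "L = conj_set (mat_inv g) L'"
    using conj_set_conj_set[OF gl(2,1) Lc(1)] mat_inv(3)[OF gl(1)] Lc(1)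
    by (simp add: L' conj_set_cj[of "1\<^sub>m N"] cj_one_left subset_iff)
  \<comment> \<open>Undoing the twist requires the inverse character, transported from
    \<open>L\<close> to \<open>L'\<close> along conjugation by the inverse of
    \<open>g\<close>.\<close>
  let ?\<kappa> = "\<lambda>l. inverse (\<kappa> (cj (mat_inv g) l))"
  have "unramified av N L' ?\<kappa>"
    using unramified_inverse[OF unramified_conj[OF av gl(2) Lc(2)]] \<kappa> L by simp
  moreover define h where "h = inv_into (fst \<sigma>') f"
  have hin: "h v \<in> fst \<sigma>'" and fh: "f (h v) = v" if "v \<in> fst \<sigma>" for v
    using that f(2) by (auto simp: h_def bij_betw_def inv_into_into f_inv_into_f)
  have hf: "h (f w) = w" if "w \<in> fst \<sigma>'" for w
    using that f(2) by (simp add: h_def bij_betw_def)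
  have fadd: "f (u + v) = f u + f v" and fscale: "f (smul c u) = smul c (f u)"
    if "u \<in> fst \<sigma>'" "v \<in> fst \<sigma>'" for u v c
    using f(1) that by (auto simp: lin_on_def)
  have V': "cfun.subspace (fst \<sigma>')"
    using st by (simp add: stable_rep_def)
  have "lin_on (fst \<sigma>) (fst \<sigma>') h"
    unfolding lin_on_def
  proof (intro conjI ballI allI)
    fix u v assume uv: "u \<in> fst \<sigma>" "v \<in> fst \<sigma>"
    have "h (f (h u + h v)) = h u + h v"
      using V' hin uv by (intro hf cfun.subspace_add)
    then show "h (u + v) = h u + h v"
      using fadd[OF hin hin] fh uv by simp
  next
    fix c v assume v: "v \<in> fst \<sigma>"
    have "h (f (smul c (h v))) = smul c (h v)"
      using V' hin v by (intro hf cfun.subspace_scale)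
    then show "h (smul c v) = smul c (h v)"
      using fscale[OF hin hin] fh v by simp
  qed (rule hin)
  moreover have "bij_betw h (fst \<sigma>) (fst \<sigma>')"
    using f(2) unfolding h_def by (rule bij_betw_inv_into)
  moreover have "h (snd \<sigma> l v) = smul (?\<kappa> (cj (mat_inv (mat_inv g)) l))
      (snd \<sigma>' (cj (mat_inv (mat_inv g)) l) (h v))" if l: "l \<in> L" and v: "v \<in> fst \<sigma>" for l v
  proof -
    let ?m = "cj g l"
    have m: "?m \<in> L'" "cj (mat_inv g) ?m = l"
      using l L' cj_inv_cancel[OF gl(1)] Lc by (auto simp: conj_set_cj)
    have nz: "\<kappa> l \<noteq> 0"
      using \<kappa> l by (simp add: unramified_def)
    have w: "snd \<sigma>' ?m (h v) \<in> fst \<sigma>'"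
      using stable_rep_act[OF st(2) m(1) hin[OF v]] .
    have "f (smul (inverse (\<kappa> l)) (snd \<sigma>' ?m (h v))) = snd \<sigma> l v"
      using f(3)[OF m(1) hin[OF v]] fscale[OF w w] nz m(2) fh[OF v] by (simp add: smul_smul smul_one)
    moreover have "h (f (smul (inverse (\<kappa> l)) (snd \<sigma>' ?m (h v)))) = smul (inverse (\<kappa> l)) (snd \<sigma>' ?m (h v))"
      using V' w by (intro hf cfun.subspace_scale)
    ultimately show ?thesis
      using m mat_inv_mat_inv[OF gl(1)] by simp
  qed
  ultimately show ?thesis
    unfolding eqs inertial_class_iff[OF B]
    using x[unfolded eqs] isom_group_inv[OF B g] L
    by (intro conjI bexI[of _ "mat_inv g"] exI[of _ ?\<kappa>] exI[of _ h]) auto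
qed

lemma bernstein_disjoint:
  assumes av: "local_field av" and B: "B \<in> gl N"
    and t: "t1 \<in> bernstein av N B" "t2 \<in> bernstein av N B" and x: "x \<in> t1" "x \<in> t2"
  shows "t1 = t2"
proof -
  obtain a1 a2 where a: "a1 \<in> cuspidal_pairs av N B" "a2 \<in> cuspidal_pairs av N B"
    and eq: "t1 = inertial_class av N B a1" "t2 = inertial_class av N B a2"
    using t by (auto simp: bernstein_def)
  have xc: "x \<in> cuspidal_pairs av N B"
    using x unfolding eq by (auto simp: inertial_class_def split: prod.splits)
  have "inertial_class av N B a \<subseteq> inertial_class av N B b"
    if "x \<in> inertial_class av N B a" "x \<in> inertial_class av N B b"
      "a \<in> cuspidal_pairs av N B" "b \<in> cuspidal_pairs av N B" for a b
  proof
    fix y assume y: "y \<in> inertial_class av N B a"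
    have "a \<in> inertial_class av N B x"
      using inertial_class_sym[OF av B] that by blast
    then have "a \<in> inertial_class av N B b"
      using inertial_class_trans[OF av B] that by blast
    then show "y \<in> inertial_class av N B b"
      using inertial_class_trans[OF av B] that y by blast
  qed
  then show ?thesis
    using a x unfolding eq by blast
qed


section \<open>Theta lifts of isomorphic representations\<close>

lemma tensor_subspace: "cfun.subspace (tensor V W)"
  by (simp add: tensor_def)

text \<open>The left-hand sides are left unsimplified because \<open>act_left\<close> and
  \<open>act_right\<close> unfold to slices of exactly this shape.\<close>

lemma pure_tensor_slice: "(\<lambda>i. (\<lambda>(i, j). v i * w j) (i, j)) = smul (w j) v"
  "(\<lambda>j. (\<lambda>(i, j). v i * w j) (i, j)) = smul (v i) w"
  by (auto simp: smul_def)

lemma plus_slice: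
  fixes y z :: "'x \<times> 'y \<Rightarrow> complex"
  shows "(\<lambda>i. (y + z) (i, j)) = (\<lambda>i. y (i, j)) + (\<lambda>i. z (i, j))"
    "(\<lambda>j. (y + z) (i, j)) = (\<lambda>j. y (i, j)) + (\<lambda>j. z (i, j))"
  by (auto simp: fun_eq_iff)

lemma smul_slice: "(\<lambda>i. smul c z (i, j)) = smul c (\<lambda>i. z (i, j))"
  "(\<lambda>j. smul c z (i, j)) = smul c (\<lambda>j. z (i, j))"
  by (auto simp: smul_def)

lemma zero_slice: "(\<lambda>i. (0 :: 'x \<times> 'y \<Rightarrow> complex) (i, j)) = 0" "(\<lambda>j. (0 :: 'x \<times> 'y \<Rightarrow> complex) (i, j)) = 0"
  by (auto simp: fun_eq_iff)

text \<open>Operators act on one factor through slices and are linear only on the given subspaces,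
  so slices must be known to stay there. Those functions whose slices do form a subspace containing
  the pure tensors.\<close>

lemma tensor_slices:
  assumes V: "cfun.subspace V" and W: "cfun.subspace W" and z: "z \<in> tensor V W"
  shows "(\<lambda>i. z (i, j)) \<in> V" and "(\<lambda>j. z (i, j)) \<in> W"
proof -
  have "(\<forall>j. (\<lambda>i. z (i, j)) \<in> V) \<and> (\<forall>i. (\<lambda>j. z (i, j)) \<in> W)"
    using z unfolding tensor_def
  proof (rule cfun.span_induct)
    show "cfun.subspace {z. (\<forall>j. (\<lambda>i. z (i, j)) \<in> V) \<and> (\<forall>i. (\<lambda>j. z (i, j)) \<in> W)}"
      unfolding cfun.subspace_def
      using V W by (auto simp only: mem_Collect_eq plus_slice smul_slice zero_slice
          intro: cfun.subspace_0 cfun.subspace_add cfun.subspace_scale)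
  next
    fix x assume "x \<in> {\<lambda>(i, j). v i * w j | v w. v \<in> V \<and> w \<in> W}"
    then obtain v w where vw: "x = (\<lambda>(i, j). v i * w j)" "v \<in> V" "w \<in> W"
      by blast
    show "(\<forall>j. (\<lambda>i. x (i, j)) \<in> V) \<and> (\<forall>i. (\<lambda>j. x (i, j)) \<in> W)"
      unfolding vw(1) pure_tensor_slice using V W vw by (auto intro: cfun.subspace_scale)
  qed
  then show "(\<lambda>i. z (i, j)) \<in> V" "(\<lambda>j. z (i, j)) \<in> W" by auto
qed

lemma pure_in_tensor: "v \<in> V \<Longrightarrow> w \<in> W \<Longrightarrow> (\<lambda>(i, j). v i * w j) \<in> tensor V W"
  unfolding tensor_def by (rule cfun.span_base) blast

text \<open>Membership in the tensor product is carried along in the sum and scaling steps, since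
  the maps to which the rule is applied are linear only there.\<close>

lemma tensor_induct:
  assumes "z \<in> tensor V W"
    and "P 0"
    and "\<And>y z. y \<in> tensor V W \<Longrightarrow> z \<in> tensor V W \<Longrightarrow> P y \<Longrightarrow> P z \<Longrightarrow> P (y + z)"
    and "\<And>c z. z \<in> tensor V W \<Longrightarrow> P z \<Longrightarrow> P (smul c z)"
    and "\<And>v w. v \<in> V \<Longrightarrow> w \<in> W \<Longrightarrow> P (\<lambda>(i, j). v i * w j)"
  shows "P z"
proof -
  have "z \<in> tensor V W \<and> P z"
    using assms(1)[unfolded tensor_def]
  proof (rule cfun.span_induct)
    show "cfun.subspace {z. z \<in> tensor V W \<and> P z}"
      unfolding cfun.subspace_def
      using assms(2-4) tensor_subspace[of V W]
      by (auto intro: cfun.subspace_0 cfun.subspace_add cfun.subspace_scale)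
  next
    fix x assume "x \<in> {\<lambda>(i, j). v i * w j | v w. v \<in> V \<and> w \<in> W}"
    then show "x \<in> tensor V W \<and> P x"
      using pure_in_tensor[of _ V _ W] assms(5) by blast
  qed
  then show ?thesis ..
qed

lemma act_left_pure:
  assumes "lin_on V V' f" "v \<in> V"
  shows "act_left f (\<lambda>(i, j). v i * w j) = (\<lambda>(i, j). f v i * w j)"
  unfolding act_left_def pure_tensor_slice using assms by (auto simp: lin_on_def smul_def)

lemma act_right_pure:
  assumes "lin_on W W' f" "w \<in> W"
  shows "act_right f (\<lambda>(i, j). v i * w j) = (\<lambda>(i, j). v i * f w j)"
  unfolding act_right_def pure_tensor_slice using assms by (auto simp: lin_on_def smul_def)

text \<open>Additivity can be read off from slices, but membership in \<open>tensor V' W\<close>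
  cannot: a function all of whose slices lie in the right spaces may fail to be a finite sum of pure
  tensors. Hence the induction over generators.\<close>

lemma lin_on_act_left:
  fixes V :: "('x \<Rightarrow> complex) set" and W :: "('y \<Rightarrow> complex) set"
  assumes V: "cfun.subspace V" and W: "cfun.subspace W" and f: "lin_on V V' f"
  shows "lin_on (tensor V W) (tensor V' W) (act_left f)"
proof -
  have add: "act_left f (y + z) = act_left f y + act_left f z" if "y \<in> tensor V W" "z \<in> tensor V W" for y z
    using f tensor_slices(1)[OF V W that(1)] tensor_slices(1)[OF V W that(2)]
    unfolding act_left_def plus_slice by (auto simp: lin_on_def fun_eq_iff)
  have scale: "act_left f (smul c z) = smul c (act_left f z)" if "z \<in> tensor V W" for c z
    using f tensor_slices(1)[OF V W that]
    unfolding act_left_def smul_slice by (auto simp: lin_on_def fun_eq_iff smul_def[of c "\<lambda>(i, j). _ i j"] smul_def[of c "f _"])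
  have "act_left f z \<in> tensor V' W" if "z \<in> tensor V W" for z
    using that
  proof (rule tensor_induct)
    have "act_left f (0 :: 'x \<times> 'y \<Rightarrow> complex) = 0"
      using lin_on_zero[OF f cfun.subspace_0[OF V]] unfolding act_left_def zero_slice by (auto simp: fun_eq_iff)
    then show "act_left f 0 \<in> tensor V' W"
      by (simp add: tensor_subspace cfun.subspace_0)
  next
    fix v w assume pure: "v \<in> V" "w \<in> W"
    then have "f v \<in> V'"
      using f by (simp add: lin_on_def)
    then show "act_left f (\<lambda>(i, j). v i * w j) \<in> tensor V' W"
      using pure_in_tensor[of "f v" V' w W] pure unfolding act_left_pure[OF f pure(1)] by simp
  next
    fix y z assume yz: "y \<in> tensor V W" "z \<in> tensor V W"
      and IH: "act_left f y \<in> tensor V' W" "act_left f z \<in> tensor V' W"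
    show "act_left f (y + z) \<in> tensor V' W"
      unfolding add[OF yz] using IH by (rule cfun.subspace_add[OF tensor_subspace])
  next
    fix c z assume z: "z \<in> tensor V W" and IH: "act_left f z \<in> tensor V' W"
    show "act_left f (smul c z) \<in> tensor V' W"
      unfolding scale[OF z] using IH by (rule cfun.subspace_scale[OF tensor_subspace])
  qed
  then show ?thesis
    unfolding lin_on_def using add scale by blast
qed

lemma lin_on_act_right:
  fixes V :: "('x \<Rightarrow> complex) set" and W :: "('y \<Rightarrow> complex) set"
  assumes V: "cfun.subspace V" and W: "cfun.subspace W" and f: "lin_on W W' f"
  shows "lin_on (tensor V W) (tensor V W') (act_right f)"
proof -
  have add: "act_right f (y + z) = act_right f y + act_right f z" if "y \<in> tensor V W" "z \<in> tensor V W" for y z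
    using f tensor_slices(2)[OF V W that(1)] tensor_slices(2)[OF V W that(2)]
    unfolding act_right_def plus_slice by (auto simp: lin_on_def fun_eq_iff)
  have scale: "act_right f (smul c z) = smul c (act_right f z)" if "z \<in> tensor V W" for c z
    using f tensor_slices(2)[OF V W that]
    unfolding act_right_def smul_slice by (auto simp: lin_on_def fun_eq_iff smul_def[of c "\<lambda>(i, j). _ i j"] smul_def[of c "f _"])
  have "act_right f z \<in> tensor V W'" if "z \<in> tensor V W" for z
    using that
  proof (rule tensor_induct)
    have "act_right f (0 :: 'x \<times> 'y \<Rightarrow> complex) = 0"
      using lin_on_zero[OF f cfun.subspace_0[OF W]] unfolding act_right_def zero_slice by (auto simp: fun_eq_iff)
    then show "act_right f 0 \<in> tensor V W'"
      by (simp add: tensor_subspace cfun.subspace_0)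
  next
    fix v w assume pure: "v \<in> V" "w \<in> W"
    then have "f w \<in> W'"
      using f by (simp add: lin_on_def)
    then show "act_right f (\<lambda>(i, j). v i * w j) \<in> tensor V W'"
      using pure_in_tensor[of v V "f w" W'] pure unfolding act_right_pure[OF f pure(2)] by simp
  next
    fix y z assume yz: "y \<in> tensor V W" "z \<in> tensor V W"
      and IH: "act_right f y \<in> tensor V W'" "act_right f z \<in> tensor V W'"
    show "act_right f (y + z) \<in> tensor V W'"
      unfolding add[OF yz] using IH by (rule cfun.subspace_add[OF tensor_subspace])
  next
    fix c z assume z: "z \<in> tensor V W" and IH: "act_right f z \<in> tensor V W'"
    show "act_right f (smul c z) \<in> tensor V W'"
      unfolding scale[OF z] using IH by (rule cfun.subspace_scale[OF tensor_subspace])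
  qed
  then show ?thesis
    unfolding lin_on_def using add scale by blast
qed

text \<open>Slicewise operators in the two variables have no evident reason to commute on arbitrary
  functions. On pure tensors they do, and both composites are linear on the tensor product.\<close>

lemma act_left_act_right:
  assumes V: "cfun.subspace V" "cfun.subspace V'" and W: "cfun.subspace W" "cfun.subspace W'"
    and f: "lin_on V V' f" and g: "lin_on W W' g" and z: "z \<in> tensor V W"
  shows "act_left f (act_right g z) = act_right g (act_left f z)"
proof -
  have l: "lin_on (tensor V W) (tensor V' W') (\<lambda>z. act_left f (act_right g z))"
    using lin_on_act_right[OF V(1) W(1) g] lin_on_act_left[OF V(1) W(2) f] by (rule lin_on_compose)
  have r: "lin_on (tensor V W) (tensor V' W') (\<lambda>z. act_right g (act_left f z))"
    using lin_on_act_left[OF V(1) W(1) f] lin_on_act_right[OF V(2) W(1) g] by (rule lin_on_compose)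
  show ?thesis
    using z
  proof (rule tensor_induct)
    show "act_left f (act_right g 0) = act_right g (act_left f 0)"
      using lin_on_zero[OF l] lin_on_zero[OF r] by (simp add: tensor_subspace cfun.subspace_0)
  next
    fix v w assume pure: "v \<in> V" "w \<in> W"
    moreover have "f v \<in> V'" "g w \<in> W'"
      using pure f g by (auto simp: lin_on_def)
    ultimately show "act_left f (act_right g (\<lambda>(i, j). v i * w j)) = act_right g (act_left f (\<lambda>(i, j). v i * w j))"
      by (simp add: act_left_pure[OF f] act_right_pure[OF g])
  next
    fix y z assume yz: "y \<in> tensor V W" "z \<in> tensor V W"
      and "act_left f (act_right g y) = act_right g (act_left f y)"
        "act_left f (act_right g z) = act_right g (act_left f z)"
    then show "act_left f (act_right g (y + z)) = act_right g (act_left f (y + z))"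
      using l r unfolding lin_on_def by metis
  next
    fix c z assume "z \<in> tensor V W" "act_left f (act_right g z) = act_right g (act_left f z)"
    then show "act_left f (act_right g (smul c z)) = act_right g (act_left f (smul c z))"
      using l r unfolding lin_on_def by metis
  qed
qed

lemma act_left_cancel:
  assumes "cfun.subspace V" "cfun.subspace W" "z \<in> tensor V W" and "\<And>v. v \<in> V \<Longrightarrow> h (f v) = v"
  shows "act_left h (act_left f z) = z"
  using assms(4) tensor_slices(1)[OF assms(1-3)] by (auto simp: act_left_def fun_eq_iff)

section \<open>The big theta lift depends only on the isomorphism class\<close>

lemma Homs_kernel_eq:
  fixes \<pi>1 \<pi>2 :: "('g, 'x) rep"
  assumes "stable_rep S \<pi>1" "stable_rep S \<pi>2" "rep_iso S \<pi>1 \<pi>2"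
  shows "(\<forall>f\<in>Homs S \<rho> \<pi>1. f v = 0) \<longleftrightarrow> (\<forall>f\<in>Homs S \<rho> \<pi>2. f v = 0)"
proof -
  have le: "\<forall>f\<in>Homs S \<rho> \<pi>2. f v = 0"
    if iso: "rep_iso S \<pi>2 \<pi>1" and zero: "\<forall>f\<in>Homs S \<rho> \<pi>1. f v = 0"
      and st: "stable_rep S \<pi>2" for \<pi>1 \<pi>2 :: "('g, 'x) rep"
  proof
    fix f assume f: "f \<in> Homs S \<rho> \<pi>2"
    obtain i where i: "i \<in> Homs S \<pi>2 \<pi>1" and bij: "bij_betw i (fst \<pi>2) (fst \<pi>1)"
      using iso by (auto simp: rep_iso_def)
    \<comment> \<open>After postcomposition with the isomorphism \<open>i\<close> the map goes to
      \<open>\<pi>1\<close> and so kills \<open>v\<close>; injectivity of \<open>i\<close> then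
      yields \<open>f v = 0\<close>.\<close>
    have "i (f v) = i 0"
      using zero Homs_comp[OF f i] Homs_0[OF i] by fastforce
    moreover have "f v \<in> fst \<pi>2"
      using Homs_in[OF f] Homs_outside[OF f] stable_rep_zero[OF st] by (cases "v \<in> fst \<rho>") auto
    ultimately show "f v = 0"
      using bij stable_rep_zero[OF st] by (auto simp: bij_betw_def dest: inj_onD)
  qed
  then show ?thesis
    using le[OF rep_iso_sym[OF assms] _ assms(2)] le[OF assms(3) _ assms(1)] by (intro iffI)
qed

text \<open>The same \<Theta> serves for both: the quotient map is followed by \<open>f\<close>
  tensored with the identity. This is a bijective intertwiner, so the kernel is unchanged, and the
  common kernel of all maps to the representation is unchanged by
  \<open>Homs_kernel_eq\<close>.\<close>

lemma big_theta_iso: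
  assumes st: "stable_rep G \<pi>1" "stable_rep G \<pi>2" and iso: "rep_iso G \<pi>1 \<pi>2"
    and \<Theta>: "big_theta G K M S \<omega> \<pi>1 \<Theta>"
  shows "big_theta G K M S \<omega> \<pi>2 \<Theta>"
proof -
  obtain p where mon: "monoid_rep K (*) (1\<^sub>m M) \<Theta>" and p: "lin_on S (tensor (fst \<pi>1) (fst \<Theta>)) p"
    and im: "p ` S = tensor (fst \<pi>1) (fst \<Theta>)"
    and act: "\<forall>g\<in>G. \<forall>h\<in>K. \<forall>\<phi>\<in>S.
      p (\<omega> g h \<phi>) = act_left (snd \<pi>1 g) (act_right (snd \<Theta> h) (p \<phi>))"
    and ker: "{\<phi>\<in>S. p \<phi> = 0} = {\<phi>\<in>S. \<forall>f\<in>Homs G (S, \<lambda>g. \<omega> g (1\<^sub>m M)) \<pi>1. f \<phi> = 0}"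
    using \<Theta> unfolding big_theta_def by (elim conjE exE) (rule that)
  obtain f g where f: "f \<in> Homs G \<pi>1 \<pi>2" and g: "g \<in> Homs G \<pi>2 \<pi>1"
    and gf: "g \<circ> f = id_hom \<pi>1" and fg: "f \<circ> g = id_hom \<pi>2"
    using iso unfolding rep_iso_iff[OF st] by blast
  have gf: "g (f v) = v" if "v \<in> fst \<pi>1" for v
    using fun_cong[OF gf, of v] that by (simp add: id_hom_def)
  have fg: "f (g v) = v" if "v \<in> fst \<pi>2" for v
    using fun_cong[OF fg, of v] that by (simp add: id_hom_def)
  note sub = st[unfolded stable_rep_def, THEN conjunct1]
    monoid_rep_stable[OF mon, unfolded stable_rep_def, THEN conjunct1]
  have lf: "lin_on (fst \<pi>1) (fst \<pi>2) f" and lg: "lin_on (fst \<pi>2) (fst \<pi>1) g"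
    using f g by (auto simp: Homs_def)
  note Lf = lin_on_act_left[OF sub(1,3) lf] and Lg = lin_on_act_left[OF sub(2,3) lg]
  define p' where "p' = (\<lambda>\<phi>. act_left f (p \<phi>))"
  have pin: "p \<phi> \<in> tensor (fst \<pi>1) (fst \<Theta>)" if "\<phi> \<in> S" for \<phi>
    using p that by (simp add: lin_on_def)
  have "lin_on S (tensor (fst \<pi>2) (fst \<Theta>)) p'"
    unfolding p'_def using p Lf by (rule lin_on_compose)
  moreover have "p' ` S = tensor (fst \<pi>2) (fst \<Theta>)"
  proof -
    have "p' ` S = act_left f ` tensor (fst \<pi>1) (fst \<Theta>)"
      unfolding im[symmetric] p'_def by (simp add: image_image)
    also have "\<dots> = tensor (fst \<pi>2) (fst \<Theta>)"
    proof
      show "act_left f ` tensor (fst \<pi>1) (fst \<Theta>) \<subseteq> tensor (fst \<pi>2) (fst \<Theta>)"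
        using Lf by (auto simp: lin_on_def)
      show "tensor (fst \<pi>2) (fst \<Theta>) \<subseteq> act_left f ` tensor (fst \<pi>1) (fst \<Theta>)"
      proof
        fix z assume z: "z \<in> tensor (fst \<pi>2) (fst \<Theta>)"
        then have "act_left f (act_left g z) = z"
          by (rule act_left_cancel[OF sub(2,3)]) (rule fg)
        moreover have "act_left g z \<in> tensor (fst \<pi>1) (fst \<Theta>)"
          using Lg z by (simp add: lin_on_def)
        ultimately show "z \<in> act_left f ` tensor (fst \<pi>1) (fst \<Theta>)"
          by (metis imageI)
      qed
    qed
    finally show ?thesis .
  qed
  moreover have "p' (\<omega> a h \<phi>) = act_left (snd \<pi>2 a) (act_right (snd \<Theta> h) (p' \<phi>))"
    if a: "a \<in> G" and h: "h \<in> K" and \<phi>: "\<phi> \<in> S" for a h \<phi>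
  proof -
    have lh: "lin_on (fst \<Theta>) (fst \<Theta>) (snd \<Theta> h)"
      using mon h by (simp add: monoid_rep_def)
    have z: "act_right (snd \<Theta> h) (p \<phi>) \<in> tensor (fst \<pi>1) (fst \<Theta>)"
      using lin_on_act_right[OF sub(1,3) lh] pin[OF \<phi>] by (simp add: lin_on_def)
    have "p' (\<omega> a h \<phi>) = act_left f (act_left (snd \<pi>1 a) (act_right (snd \<Theta> h) (p \<phi>)))"
      using act a h \<phi> by (simp add: p'_def)
    \<comment> \<open>Both operators act on the left factor, so it is enough that \<open>f\<close>
      intertwines each slice. The interchange with the right factor in the next equation relies on
      linearity over the tensor product.\<close>
    also have "\<dots> = act_left (snd \<pi>2 a) (act_left f (act_right (snd \<Theta> h) (p \<phi>)))"
      using Homs_act[OF f a] tensor_slices(1)[OF sub(1,3) z] by (auto simp: act_left_def fun_eq_iff)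
    also have "act_left f (act_right (snd \<Theta> h) (p \<phi>)) = act_right (snd \<Theta> h) (p' \<phi>)"
      unfolding p'_def by (rule act_left_act_right[OF sub(1,2,3,3) lf lh pin[OF \<phi>]])
    finally show ?thesis .
  qed
  moreover have "{\<phi>\<in>S. p' \<phi> = 0} = {\<phi>\<in>S. \<forall>f\<in>Homs G (S, \<lambda>g. \<omega> g (1\<^sub>m M)) \<pi>2. f \<phi> = 0}"
  proof -
    have "p' \<phi> = 0 \<longleftrightarrow> p \<phi> = 0" if "\<phi> \<in> S" for \<phi>
    proof
      assume "p' \<phi> = 0"
      moreover have "act_left g (p' \<phi>) = p \<phi>"
        unfolding p'_def using pin[OF that] by (rule act_left_cancel[OF sub(1,3)]) (rule gf)
      ultimately show "p \<phi> = 0"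
        using lin_on_zero[OF Lg] by (simp add: tensor_subspace cfun.subspace_0)
    next
      assume "p \<phi> = 0"
      then show "p' \<phi> = 0"
        using lin_on_zero[OF Lf] by (simp add: p'_def tensor_subspace cfun.subspace_0)
    qed
    then show ?thesis
      using ker Homs_kernel_eq[OF st iso, of "(S, \<lambda>g. \<omega> g (1\<^sub>m M))"] by blast
  qed
  ultimately show ?thesis
    using mon unfolding big_theta_def by blast
qed

lemma small_theta_iso:
  assumes "smooth_rep av (2 * n) (Sp n) \<pi>1" "smooth_rep av (2 * n) (Sp n) \<pi>2" "rep_iso (Sp n) \<pi>1 \<pi>2"
    and "small_theta av n n' Q \<omega> \<pi>1 \<pi>'"
  shows "small_theta av n n' Q \<omega> \<pi>2 \<pi>'"
  using assms(4) big_theta_iso[OF smooth_rep_stable smooth_rep_stable, OF assms(1-3)]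
  unfolding small_theta_def Theta_lift_def by blast

text \<open>Needed for surjectivity of the correspondence: its source is cut out by a non-zero big
  lift, its target by the existence of a small one.\<close>

lemma small_theta_Theta_nonzero:
  assumes "small_theta av n n' Q \<omega> \<pi> \<pi>'" shows "Theta_nonzero av n n' Q \<omega> \<pi>"
proof -
  have irr: "fst \<pi>' \<noteq> {0}"
    using assms by (simp add: small_theta_def Irr_smooth_def irreducible_rep_def)
  obtain \<Theta> where \<Theta>: "Theta_lift av n n' Q \<omega> \<pi> \<Theta>" and q: "is_quotient (isom_group (2 * n') Q) \<Theta> \<pi>'"
    using assms unfolding small_theta_def by blast
  obtain f where f: "f \<in> Homs (isom_group (2 * n') Q) \<Theta> \<pi>'" and im: "f ` fst \<Theta> = fst \<pi>'"
    using q unfolding is_quotient_def by (rule bexE)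
  have "fst \<Theta> \<noteq> {0}"
    using im irr Homs_0[OF f] by auto
  then show ?thesis
    using \<Theta> unfolding Theta_nonzero_def by blast
qed


section \<open>Bernstein blocks\<close>

lemma Irr_block_Irr_smooth: "\<pi> \<in> Irr_block av N B t \<Longrightarrow> \<pi> \<in> Irr_smooth av N (isom_group N B)"
  by (auto simp: Irr_block_def bernstein_block_def Irr_smooth_def)

text \<open>The block condition ranges over all irreducible subquotients. Those of an irreducible
  \<pi> are isomorphic to \<pi>, and supports are isomorphism invariant because they are defined by
  occurrence as a subquotient.\<close>

lemma Irr_blockI:
  assumes \<pi>: "\<pi> \<in> Irr_smooth av N (isom_group N B)" and "supp av N B \<pi> \<noteq> {}" "supp av N B \<pi> \<subseteq> t"
  shows "\<pi> \<in> Irr_block av N B t"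
proof -
  let ?G = "isom_group N B"
  have st: "stable_rep ?G \<rho>" if "\<rho> \<in> Irr_smooth av N ?G" for \<rho>
    using that by (auto simp: Irr_smooth_def intro: smooth_rep_stable)
  have "supp av N B \<rho> = supp av N B \<pi>"
    if \<rho>: "\<rho> \<in> Irr_smooth av N ?G" "is_subquotient ?G \<pi> \<rho>" for \<rho>
  proof -
    have "rep_iso ?G \<pi> \<rho>"
      using \<pi> \<rho> st by (intro irreducible_subquotient_iso) (auto simp: Irr_smooth_def)
    moreover from this have "rep_iso ?G \<rho> \<pi>"
      using st \<pi> \<rho> by (intro rep_iso_sym[of ?G \<pi> \<rho>]) auto
    \<comment> \<open>The type is that of \<open>induced\<close>, whose subquotients
      \<open>supp\<close> inspects.\<close>
    ultimately have "is_subquotient ?G \<tau> \<rho> \<longleftrightarrow> is_subquotient ?G \<tau> \<pi>" for \<tau> :: "('a mat, 'a mat \<times> nat) rep"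
      by (blast intro: is_subquotient_iso)
    then show ?thesis
      unfolding supp_def by simp
  qed
  then show ?thesis
    using assms by (auto simp: Irr_block_def bernstein_block_def Irr_smooth_def)
qed

section \<open>Module categories and Bernstein blocks are closed under subobjects\<close>

lemma monoid_rep_subrep:
  assumes "monoid_rep S mul e \<pi>" "invariant_subspace S \<pi> U" shows "monoid_rep S mul e (U, snd \<pi>)"
proof -
  have "stable_rep S (U, snd \<pi>)"
    using subrep_stable[OF monoid_rep_stable[OF assms(1)] assms(2)] .
  then show ?thesis
    using assms by (auto simp: monoid_rep_def stable_rep_def invariant_subspace_def subset_iff)
qed

lemma modules_subrep:
  assumes "M \<in> modules A" "invariant_subspace (alg_set A) M U" shows "(U, snd M) \<in> modules A"
  using assms monoid_rep_subrep[OF _ assms(2)]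
  by (auto simp: modules_def lin_on_def invariant_subspace_def subset_iff)

lemma is_subquotient_subrep:
  assumes "invariant_subspace S \<pi> U" "is_subquotient S (U, snd \<pi>) \<rho>" shows "is_subquotient S \<pi> \<rho>"
proof -
  obtain W where W: "invariant_subspace S (U, snd \<pi>) W" and q: "is_quotient S (W, snd \<pi>) \<rho>"
    using assms(2) by (auto simp: is_subquotient_def)
  have "invariant_subspace S \<pi> W"
    using W assms(1) by (auto simp: invariant_subspace_def)
  then show ?thesis
    using q unfolding is_subquotient_def by blast
qed

lemma smooth_rep_subrep:
  assumes "smooth_rep av N G \<pi>" "invariant_subspace G \<pi> U" shows "smooth_rep av N G (U, snd \<pi>)"
  using assms monoid_rep_subrep[OF _ assms(2)]
  by (auto simp: smooth_rep_def invariant_subspace_def subset_iff)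

lemma bernstein_block_subrep:
  assumes "\<pi> \<in> bernstein_block av N B t" and U: "invariant_subspace (isom_group N B) \<pi> U"
  shows "(U, snd \<pi>) \<in> bernstein_block av N B t"
  using assms(1) smooth_rep_subrep[OF _ U] is_subquotient_subrep[OF U]
  unfolding bernstein_block_def by blast

section \<open>Passing from irreducible representations in a block to simple modules\<close>

lemma heiermann_equivalence:
  assumes "heiermann av N B t C Fo Fm"
  shows "rep_equivalence (isom_group N B) (bernstein_block av N B t) (alg_set C) (modules C) Fo Fm"
proof
  show "cat_equivalence (isom_group N B) (bernstein_block av N B t) (alg_set C) (modules C) Fo Fm"
    using assms by (simp add: heiermann_def)
  show "stable_rep (isom_group N B) \<pi>" if "\<pi> \<in> bernstein_block av N B t" for \<pi>
    using that by (auto simp: bernstein_block_def intro: smooth_rep_stable)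
qed (auto intro: modules_stable modules_subrep bernstein_block_subrep simp del: split_paired_All)

lemma heiermann_Irr:
  assumes "heiermann av N B t C Fo Fm" "\<pi> \<in> Irr_block av N B t"
  shows "iso_class (alg_set C) (modules C) (Fo \<pi>) \<in> Irr_alg C"
proof -
  interpret rep_equivalence "isom_group N B" "bernstein_block av N B t" "alg_set C" "modules C" Fo Fm
    using heiermann_equivalence[OF assms(1)] .
  show ?thesis
    using assms(2) object[of \<pi>] irreducible_object[of \<pi>] by (auto simp: Irr_block_def Irr_alg_def)
qed

lemma heiermann_iso_class_eq_iff:
  assumes "heiermann av N B t C Fo Fm" "\<pi>1 \<in> Irr_block av N B t" "\<pi>2 \<in> Irr_block av N B t"
  shows "iso_class (alg_set C) (modules C) (Fo \<pi>1) = iso_class (alg_set C) (modules C) (Fo \<pi>2) \<longleftrightarrow>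
    rep_iso (isom_group N B) \<pi>1 \<pi>2"
proof -
  interpret rep_equivalence "isom_group N B" "bernstein_block av N B t" "alg_set C" "modules C" Fo Fm
    using heiermann_equivalence[OF assms(1)] .
  have "\<pi>1 \<in> bernstein_block av N B t" "\<pi>2 \<in> bernstein_block av N B t"
    using assms(2,3) by (auto simp: Irr_block_def)
  then show ?thesis
    using iso_class_eq_iff[OF modules_stable object object] iso_iff by blast
qed

text \<open>One existing lift makes the description meaningful. Kudla's class satisfies it; any
  other candidate contains a non-empty support that also lies in Kudla's class, and inertial classes
  with a common pair coincide.\<close>

lemma theta_class_block:
  assumes av: "local_field av" and Q: "quadratic_space (2 * n') Q" and kudla: "kudla_blocks av n n' Q \<omega>"
    and s: "s \<in> bernstein av (2 * n) (symplectic_form n)"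
    and \<pi>: "\<pi> \<in> Irr_block av (2 * n) (symplectic_form n) s" and \<pi>': "small_theta av n n' Q \<omega> \<pi> \<pi>'"
  shows "theta_class av n n' Q \<omega> s \<in> bernstein av (2 * n') Q"
    and "\<pi>' \<in> Irr_block av (2 * n') Q (theta_class av n n' Q \<omega> s)"
proof -
  obtain t where t: "t \<in> bernstein av (2 * n') Q"
    and supp: "\<And>\<pi> \<pi>'. \<pi> \<in> Irr_block av (2 * n) (symplectic_form n) s \<Longrightarrow> small_theta av n n' Q \<omega> \<pi> \<pi>' \<Longrightarrow>
      supp av (2 * n') Q \<pi>' \<noteq> {} \<and> supp av (2 * n') Q \<pi>' \<subseteq> t"
    using kudla s unfolding kudla_blocks_def by meson
  have Qgl: "Q \<in> gl (2 * n')"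
    using Q by (simp add: quadratic_space_def gl_def)
  have eq: "theta_class av n n' Q \<omega> s = t"
    unfolding theta_class_def
  proof (rule the_equality)
    show "t \<in> bernstein av (2 * n') Q \<and> (\<exists>\<pi>\<in>Irr_block av (2 * n) (symplectic_form n) s. \<exists>\<pi>'.
        small_theta av n n' Q \<omega> \<pi> \<pi>' \<and> supp av (2 * n') Q \<pi>' \<noteq> {} \<and> supp av (2 * n') Q \<pi>' \<subseteq> t)"
      using t \<pi> \<pi>' supp by blast
    fix t' assume "t' \<in> bernstein av (2 * n') Q \<and> (\<exists>\<pi>\<in>Irr_block av (2 * n) (symplectic_form n) s. \<exists>\<pi>'.
        small_theta av n n' Q \<omega> \<pi> \<pi>' \<and> supp av (2 * n') Q \<pi>' \<noteq> {} \<and> supp av (2 * n') Q \<pi>' \<subseteq> t')"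
    then obtain x where "t' \<in> bernstein av (2 * n') Q" "x \<in> t" "x \<in> t'"
      using supp by blast
    then show "t' = t"
      using bernstein_disjoint[OF av Qgl] t by blast
  qed
  show "theta_class av n n' Q \<omega> s \<in> bernstein av (2 * n') Q"
    using eq t by simp
  show "\<pi>' \<in> Irr_block av (2 * n') Q (theta_class av n n' Q \<omega> s)"
    unfolding eq using \<pi>' supp[OF \<pi> \<pi>'] by (intro Irr_blockI) (auto simp: small_theta_def)
qed

text \<open>By Howe duality each \<pi> with a non-zero big lift has a small lift, so the last clause
  fixes \<theta> on all of \<open>D\<close>; bijectivity then forces \<open>D'\<close> to consist of
  the classes coming from small lifts.\<close>

theorem theorem5p1p4:
  fixes av :: "'f::field \<Rightarrow> real"
    and \<psi> :: "'f \<Rightarrow> complex"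
    and n n' :: nat
    and Q :: "'f mat"
    and \<omega> :: "'f mat \<Rightarrow> 'f mat \<Rightarrow> ('f mat \<Rightarrow> complex) \<Rightarrow> 'f mat \<Rightarrow> complex"
    and H H' :: "'f cusp_pair set \<Rightarrow> nat calg"
    and Fo Fo' :: "'f cusp_pair set \<Rightarrow> ('f mat, nat) rep \<Rightarrow> (nat \<Rightarrow> complex, nat) rep"
    and Fm Fm' :: "'f cusp_pair set \<Rightarrow> ('f mat, nat) rep \<Rightarrow> ('f mat, nat) rep \<Rightarrow>
      ((nat \<Rightarrow> complex) \<Rightarrow> nat \<Rightarrow> complex) \<Rightarrow> (nat \<Rightarrow> complex) \<Rightarrow> nat \<Rightarrow> complex"
    and s :: "'f cusp_pair set"
  assumes "local_field av"
    and "additive_character av \<psi>"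
    and "quadratic_space (2 * n') Q"
    and "weil_rep av \<psi> n n' Q \<omega>"
    and howe: "howe_duality av n n' Q \<omega>"
    and kudla: "kudla_blocks av n n' Q \<omega>"
    and heiermann_Sp: "\<And>t. t \<in> bernstein av (2 * n) (symplectic_form n) \<Longrightarrow>
      heiermann av (2 * n) (symplectic_form n) t (H t) (Fo t) (Fm t)"
    and heiermann_O: "\<And>t. t \<in> bernstein av (2 * n') Q \<Longrightarrow>
      heiermann av (2 * n') Q t (H' t) (Fo' t) (Fm' t)"
    and "s \<in> bernstein av (2 * n) (symplectic_form n)"
  shows "\<exists>D D' \<theta>.
    D = {iso_class (alg_set (H s)) (modules (H s)) (Fo s \<pi>) | \<pi>.
      \<pi> \<in> Irr_block av (2 * n) (symplectic_form n) s \<and> Theta_nonzero av n n' Q \<omega> \<pi>} \<and>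
    D \<subseteq> Irr_alg (H s) \<and> D' \<subseteq> Irr_alg (H' (theta_class av n n' Q \<omega> s)) \<and> bij_betw \<theta> D D' \<and>
    (\<forall>\<pi>\<in>Irr_block av (2 * n) (symplectic_form n) s. \<forall>\<pi>'. small_theta av n n' Q \<omega> \<pi> \<pi>' \<longrightarrow>
      theta_class av n n' Q \<omega> s \<in> bernstein av (2 * n') Q \<and>
      \<pi>' \<in> Irr_block av (2 * n') Q (theta_class av n n' Q \<omega> s) \<and>
      \<theta> (iso_class (alg_set (H s)) (modules (H s)) (Fo s \<pi>)) =
        iso_class (alg_set (H' (theta_class av n n' Q \<omega> s))) (modules (H' (theta_class av n n' Q \<omega> s)))
          (Fo' (theta_class av n n' Q \<omega> s) \<pi>'))"
proof -
  let ?s = "Irr_block av (2 * n) (symplectic_form n) s"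
  let ?t = "theta_class av n n' Q \<omega> s"
  let ?G' = "isom_group (2 * n') Q"
  let ?c = "\<lambda>\<pi>. iso_class (alg_set (H s)) (modules (H s)) (Fo s \<pi>)"
  let ?c' = "\<lambda>\<pi>'. iso_class (alg_set (H' ?t)) (modules (H' ?t)) (Fo' ?t \<pi>')"
  let ?D = "{?c \<pi> | \<pi>. \<pi> \<in> ?s \<and> Theta_nonzero av n n' Q \<omega> \<pi>}"
  \<comment> \<open>The target is chosen as the set of classes of all small lifts from the block;
    without any lift it is empty, like \<open>?D\<close>, and nothing has to be known about
    \<open>?t\<close>.\<close>
  let ?D' = "{?c' \<pi>' | \<pi> \<pi>'. \<pi> \<in> ?s \<and> small_theta av n n' Q \<omega> \<pi> \<pi>'}"
  have s: "s \<in> bernstein av (2 * n) (symplectic_form n)" and Q: "quadratic_space (2 * n') Q"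
    and av: "local_field av"
    using assms by blast+
  note block = theta_class_block[OF av Q kudla s]
  have smooth: "smooth_rep av (2 * n) (Sp n) \<pi>" and irr: "\<pi> \<in> Irr_smooth av (2 * n) (Sp n)"
    if "\<pi> \<in> ?s" for \<pi>
    using Irr_block_Irr_smooth[OF that] by (auto simp: Irr_smooth_def)
  have lift: "\<exists>\<pi>'. small_theta av n n' Q \<omega> \<pi> \<pi>'" if "\<pi> \<in> ?s" "Theta_nonzero av n n' Q \<omega> \<pi>" for \<pi>
    using howe that irr[OF that(1)] unfolding howe_duality_def Let_def by blast
  have unique: "rep_iso ?G' \<pi>1' \<pi>2'"
    if "\<pi> \<in> ?s" "small_theta av n n' Q \<omega> \<pi> \<pi>1'" "small_theta av n n' Q \<omega> \<pi> \<pi>2'" for \<pi> \<pi>1' \<pi>2'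
    using howe that irr[OF that(1)] unfolding howe_duality_def Let_def by blast
  have inj: "rep_iso (Sp n) \<pi>1 \<pi>2"
    if "\<pi>1 \<in> ?s" "\<pi>2 \<in> ?s" "small_theta av n n' Q \<omega> \<pi>1 \<pi>1'" "small_theta av n n' Q \<omega> \<pi>2 \<pi>2'"
      "rep_iso ?G' \<pi>1' \<pi>2'" for \<pi>1 \<pi>2 \<pi>1' \<pi>2'
    using howe that irr[OF that(1)] irr[OF that(2)] unfolding howe_duality_def Let_def by blast
  \<comment> \<open>From left to right this makes the correspondence well defined, by isomorphism
    invariance of small lifts and their uniqueness; from right to left it makes it injective, by the
    second half of Howe duality.\<close>
  have eq_iff: "?c \<pi>1 = ?c \<pi>2 \<longleftrightarrow> ?c' \<pi>1' = ?c' \<pi>2'"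
    if \<pi>: "\<pi>1 \<in> ?s" "\<pi>2 \<in> ?s" and \<pi>': "small_theta av n n' Q \<omega> \<pi>1 \<pi>1'" "small_theta av n n' Q \<omega> \<pi>2 \<pi>2'"
    for \<pi>1 \<pi>2 \<pi>1' \<pi>2'
  proof -
    have "rep_iso (Sp n) \<pi>1 \<pi>2 \<longleftrightarrow> rep_iso ?G' \<pi>1' \<pi>2'"
      using unique[OF \<pi>(2) small_theta_iso[OF smooth[OF \<pi>(1)] smooth[OF \<pi>(2)] _ \<pi>'(1)] \<pi>'(2)] inj[OF \<pi> \<pi>']
      by blast
    \<comment> \<open>That \<open>?t\<close> is an inertial class whose block contains the lifts is
      known only in the presence of a lift, so \<open>block\<close> is instantiated with the given
      ones.\<close>
    then show ?thesis
      using heiermann_iso_class_eq_iff[OF heiermann_Sp[OF s] \<pi>]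
        heiermann_iso_class_eq_iff[OF heiermann_O block(2) block(2), OF block(1) \<pi>(1) \<pi>'(1) \<pi>(2) \<pi>'(2), OF \<pi>(1) \<pi>'(1)]
      by simp
  qed
  \<comment> \<open>A class does not remember a representative, so the value is chosen among the
    classes of lifts of all representatives; \<open>eq_iff\<close> shows that there is only
    one.\<close>
  define th where "th = (\<lambda>E. SOME E'. \<exists>\<pi>\<in>?s. \<exists>\<pi>'. small_theta av n n' Q \<omega> \<pi> \<pi>' \<and> E = ?c \<pi> \<and> E' = ?c' \<pi>')"
  have th: "th (?c \<pi>) = ?c' \<pi>'" if \<pi>: "\<pi> \<in> ?s" and \<pi>': "small_theta av n n' Q \<omega> \<pi> \<pi>'" for \<pi> \<pi>'
    unfolding th_def
  proof (rule some_equality)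
    show "\<exists>\<rho>\<in>?s. \<exists>\<rho>'. small_theta av n n' Q \<omega> \<rho> \<rho>' \<and> ?c \<pi> = ?c \<rho> \<and> ?c' \<pi>' = ?c' \<rho>'"
      using \<pi> \<pi>' by blast
    fix E' assume "\<exists>\<rho>\<in>?s. \<exists>\<rho>'. small_theta av n n' Q \<omega> \<rho> \<rho>' \<and> ?c \<pi> = ?c \<rho> \<and> E' = ?c' \<rho>'"
    then obtain \<rho> \<rho>' where \<rho>: "\<rho> \<in> ?s" "small_theta av n n' Q \<omega> \<rho> \<rho>'" "?c \<pi> = ?c \<rho>" "E' = ?c' \<rho>'"
      by blast
    then show "E' = ?c' \<pi>'"
      using eq_iff[OF \<pi> \<rho>(1) \<pi>' \<rho>(2)] by simp
  qed
  have D: "\<exists>\<pi>\<in>?s. \<exists>\<pi>'. small_theta av n n' Q \<omega> \<pi> \<pi>' \<and> E = ?c \<pi>" if "E \<in> ?D" for E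
    using that lift by blast
  have "inj_on th ?D"
  proof (rule inj_onI)
    fix E1 E2 assume E: "E1 \<in> ?D" "E2 \<in> ?D" and eq: "th E1 = th E2"
    obtain \<pi>1 \<pi>1' where 1: "\<pi>1 \<in> ?s" "small_theta av n n' Q \<omega> \<pi>1 \<pi>1'" "E1 = ?c \<pi>1"
      using D[OF E(1)] by blast
    obtain \<pi>2 \<pi>2' where 2: "\<pi>2 \<in> ?s" "small_theta av n n' Q \<omega> \<pi>2 \<pi>2'" "E2 = ?c \<pi>2"
      using D[OF E(2)] by blast
    show "E1 = E2"
      using eq eq_iff[OF 1(1) 2(1) 1(2) 2(2)] th[OF 1(1,2)] th[OF 2(1,2)] 1(3) 2(3) by simp
  qed
  moreover have "th ` ?D \<subseteq> ?D'"
  proof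
    fix E' assume "E' \<in> th ` ?D"
    then obtain E where E: "E \<in> ?D" "E' = th E"
      by (rule imageE)
    obtain \<pi> \<pi>' where "\<pi> \<in> ?s" "small_theta av n n' Q \<omega> \<pi> \<pi>'" "E = ?c \<pi>"
      using D[OF E(1)] by blast
    then show "E' \<in> ?D'"
      using th E(2) by blast
  qed
  moreover have "?D' \<subseteq> th ` ?D"
  proof
    fix E' assume "E' \<in> ?D'"
    then obtain \<pi> \<pi>' where \<pi>: "\<pi> \<in> ?s" "small_theta av n n' Q \<omega> \<pi> \<pi>'" and E': "E' = ?c' \<pi>'"
      by blast
    have "?c \<pi> \<in> ?D"
      using \<pi> small_theta_Theta_nonzero[OF \<pi>(2)] by blast
    then show "E' \<in> th ` ?D"
      unfolding E' th[OF \<pi>, symmetric] by (rule imageI)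
  qed
  ultimately have bij: "bij_betw th ?D ?D'"
    by (simp add: bij_betw_def subset_antisym)
  have D_Irr: "?D \<subseteq> Irr_alg (H s)"
    using heiermann_Irr[OF heiermann_Sp[OF s]] by blast
  have D'_Irr: "?D' \<subseteq> Irr_alg (H' ?t)"
    using heiermann_Irr[OF heiermann_O] block by blast
  show ?thesis
    by (rule exI[of _ ?D], rule exI[of _ ?D'], rule exI[of _ th])
      (intro conjI ballI allI impI refl D_Irr D'_Irr bij block th)
qed

end
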